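(* Let $(T_1,T_2)$ be a compatible $\mathcal{O}$-operator on an $A$-bimodule $M$ over an associative algebra $A$, and let $M^{\mathrm{Ind}}=(M,\prec_{T_1},\succ_{T_1},\prec_{T_2},\succ_{T_2})$ be the induced compatible dendriform algebra, $u\prec_{T_i}v=u\cdot T_i(v)$, $u\succ_{T_i}v=T_i(u)\cdot v$ for $i=1,2$. For $n\ge1$ define $$\Psi_n:C^n_{\mathrm{cO}}(M,A)\to C^{n+1}_{\mathrm{cDend}}(M^{\mathrm{Ind}},M^{\mathrm{Ind}}),\qquad\Psi_n((f_1,\ldots,f_{n+1}))=(f_1^{\mathrm{Ind}},\ldots,f_{n+1}^{\mathrm{Ind}}),$$ $$f_i^{\mathrm{Ind}}([r];u_1,\ldots,u_{n+1})=\begin{cases}(-1)^{n+1}u_1\cdot f_i(u_2,\ldots,u_{n+1})&\text{if }[r]=[1],\\ f_i(u_1,\ldots,u_n)\cdot u_{n+1}&\text{if }[r]=[n+1],\\ 0&\text{otherwise.}\end{cases}$$ Then the collection $\{\Psi_n\}_{n\ge1}$ induces a morphism $H^\bullet_{(T_1,T_2)}(M,A)\to H^{\bullet+1}_{\mathrm{cDend}}(M^{\mathrm{Ind}},M^{\mathrm{Ind}})$ from the cohomology of the compatible $\mathcal{O}$-operator $(T_1,T_2)$ to the cohomology of the induced compatible dendriform algebra $M^{\mathrm{Ind}}$.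
   Context: All vector spaces are over a field $\mathbf{k}$ of characteristic $0$; $\cdot$ denotes the product of $A$ and both actions on $M$. An $\mathcal{O}$-operator on $M$ over $A$ is a linear map $T:M\to A$ with $T(u)\cdot T(v)=T(T(u)\cdot v+u\cdot T(v))$ for all $u,v\in M$. A compatible $\mathcal{O}$-operator is a pair $(T_1,T_2)$ of $\mathcal{O}$-operators such that for all $u,v\in M$ $$T_1(u)\cdot T_2(v)+T_2(u)\cdot T_1(v)=T_1(T_2(u)\cdot v+u\cdot T_2(v))+T_2(T_1(u)\cdot v+u\cdot T_1(v)).$$ Cohomology of $(T_1,T_2)$. For linear $T:M\to A$, $a\in A$, $f\in\mathrm{Hom}(M^{\otimes n},A)$, $n\ge1$, put $$[T,a](u)=T(a\cdot u-u\cdot a)+T(u)\cdot a-a\cdot T(u),$$ $$[T,f](u_1,\ldots,u_{n+1})=T(f(u_1,\ldots,u_n)\cdot u_{n+1})-(-1)^nT(u_1\cdot f(u_2,\ldots,u_{n+1}))$$ $$-(-1)^n\Big\{\sum_{i=1}^n(-1)^{i-1}f(u_1,\ldots,u_{i-1},T(u_i)\cdot u_{i+1},u_{i+2},\ldots,u_{n+1})-\sum_{i=1}^n(-1)^if(u_1,\ldots,u_{i-1},u_i\cdot T(u_{i+1}),u_{i+2},\ldots,u_{n+1})\Big\}$$ $$+(-1)^n\big\{T(u_1)\cdot f(u_2,\ldots,u_{n+1})-(-1)^nf(u_1,\ldots,u_n)\cdot T(u_{n+1})\big\}.$$ Let $C^0_{\mathrm{cO}}(M,A)=A$ and, for $n\ge1$,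 $C^n_{\mathrm{cO}}(M,A)$ be the direct sum of $n+1$ copies of $\mathrm{Hom}(M^{\otimes n},A)$, with differential $\delta_{(T_1,T_2)}(a)=([T_1,a],[T_2,a])$ and $$\delta_{(T_1,T_2)}((f_1,\ldots,f_{n+1}))=\big([T_1,f_1],\ldots,\underbrace{[T_1,f_i]+[T_2,f_{i-1}]}_{i\text{-th place}},\ldots,[T_2,f_{n+1}]\big).$$ The cohomology groups are $H^\bullet_{(T_1,T_2)}(M,A)$. Compatible dendriform algebras. A dendriform algebra is $(D,\prec,\succ)$ with bilinear operations satisfying $(x\prec y)\prec z=x\prec(y\prec z+y\succ z)$, $(x\succ y)\prec z=x\succ(y\prec z)$, $(x\prec y+x\succ y)\succ z=x\succ(y\succ z)$. A compatible dendriform algebra is $(D,\prec_1,\succ_1,\prec_2,\succ_2)$ such that $(D,\prec_1,\succ_1)$, $(D,\prec_2,\succ_2)$ and $(D,\prec_1+\prec_2,\succ_1+\succ_2)$ are dendriform algebras; $M^{\mathrm{Ind}}$ is one. Cohomology of a compatible dendriform algebra. Let $C_n=\{[1],\ldots,[n]\}$ (symbols) and $\mathbf{k}[C_n]$ the vector space with basis $C_n$. For $m,n\ge1$, $1\le i\le m$, define $R_{m;i,n}:C_{m+n-1}\to C_m$ by $R_{m;i,n}([r])=[r]$ if $r\le i-1$, $=[i]$ if $i\le r\le i+n-1$, $=[r-n+1]$ if $r\ge i+n$; and $S_{m;i,n}:C_{m+n-1}\to\mathbf{k}[C_n]$ by $S_{m;i,n}([r])=[r-i+1]$ if $i\le r\le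 i+n-1$, and $=[1]+\cdots+[n]$ otherwise. For $f\in\mathrm{Hom}(\mathbf{k}[C_m]\otimes D^{\otimes m},D)$, $g\in\mathrm{Hom}(\mathbf{k}[C_n]\otimes D^{\otimes n},D)$ put $$(f\circ_ig)([r];x_1,\ldots,x_{m+n-1})=f\big(R_{m;i,n}[r];x_1,\ldots,x_{i-1},g(S_{m;i,n}[r];x_i,\ldots,x_{i+n-1}),x_{i+n},\ldots,x_{m+n-1}\big),$$ $$\{\!\!\{f,g\}\!\!\}=\sum_{i=1}^m(-1)^{(i-1)(n-1)}f\circ_ig-(-1)^{(m-1)(n-1)}\sum_{i=1}^n(-1)^{(i-1)(m-1)}g\circ_if.$$ Define $\pi_j\in\mathrm{Hom}(\mathbf{k}[C_2]\otimes D^{\otimes2},D)$, $j=1,2$, by $\pi_j([1];x,y)=x\prec_jy$, $\pi_j([2];x,y)=x\succ_jy$. For $n\ge1$ let $C^n_{\mathrm{cDend}}(D,D)$ be the direct sum of $n$ copies of $\mathrm{Hom}(\mathbf{k}[C_n]\otimes D^{\otimes n},D)$, with differential $$\delta_{\mathrm{cDend}}((f_1,\ldots,f_n))=(-1)^{n-1}\big(\{\!\!\{\pi_1,f_1\}\!\!\},\ldots,\underbrace{\{\!\!\{\pi_1,f_i\}\!\!\}+\{\!\!\{\pi_2,f_{i-1}\}\!\!\}}_{i\text{-th place}},\ldots,\{\!\!\{\pi_2,f_n\}\!\!\}\big).$$ The complex starts in degree $1$; its cohomology is $H^\bullet_{\mathrm{cDend}}(D,D)$. The induced morphism is in degrees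 $\bullet\ge1$, where the $\Psi_n$ are defined. *)

theory Defs
  imports Complex_Main "HOL-Library.Function_Algebras" "HOL-Library.FuncSet"
begin

section \<open>Algebras, bimodules, compatible O-operators\<close>

definition bilinear_map ::
  "('k::field \<Rightarrow> 'x::ab_group_add \<Rightarrow> 'x) \<Rightarrow> ('k \<Rightarrow> 'y::ab_group_add \<Rightarrow> 'y) \<Rightarrow>
   ('k \<Rightarrow> 'z::ab_group_add \<Rightarrow> 'z) \<Rightarrow> ('x \<Rightarrow> 'y \<Rightarrow> 'z) \<Rightarrow> bool" where
  "bilinear_map sx sy sz b \<longleftrightarrow>
     (\<forall>x. Vector_Spaces.linear sy sz (b x)) \<and> (\<forall>y. Vector_Spaces.linear sx sz (\<lambda>x. b x y))"

text \<open>Algebras need not be unital. Associativity of the product is part of the class \<open>ring\<close>.\<close>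

locale assoc_algebra = vector_space sA
  for sA :: "'k::field \<Rightarrow> 'a::ring \<Rightarrow> 'a" +
  assumes mult_bilinear: "bilinear_map sA sA sA (*)"

locale bimodule = A: assoc_algebra sA + M: vector_space sM
  for sA :: "'k::field \<Rightarrow> 'a::ring \<Rightarrow> 'a"
    and sM :: "'k \<Rightarrow> 'm::ab_group_add \<Rightarrow> 'm" +
  fixes l :: "'a \<Rightarrow> 'm \<Rightarrow> 'm"
    and r :: "'m \<Rightarrow> 'a \<Rightarrow> 'm"
  assumes l_bilinear: "bilinear_map sA sM sM l"
    and r_bilinear: "bilinear_map sM sA sM r"
    and l_mult: "l (a * b) u = l a (l b u)"
    and r_mult: "r u (a * b) = r (r u a) b"
    and l_r: "r (l a u) b = l a (r u b)"

definition O_operator ::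
  "('k::field \<Rightarrow> 'a::ring \<Rightarrow> 'a) \<Rightarrow> ('k \<Rightarrow> 'm::ab_group_add \<Rightarrow> 'm) \<Rightarrow>
   ('a \<Rightarrow> 'm \<Rightarrow> 'm) \<Rightarrow> ('m \<Rightarrow> 'a \<Rightarrow> 'm) \<Rightarrow> ('m \<Rightarrow> 'a) \<Rightarrow> bool" where
  "O_operator sA sM l r T \<longleftrightarrow>
     Vector_Spaces.linear sM sA T \<and>
     (\<forall>u v. T u * T v = T (l (T u) v + r u (T v)))"

definition compatible_O_operator ::
  "('k::field \<Rightarrow> 'a::ring \<Rightarrow> 'a) \<Rightarrow> ('k \<Rightarrow> 'm::ab_group_add \<Rightarrow> 'm) \<Rightarrow>
   ('a \<Rightarrow> 'm \<Rightarrow> 'm) \<Rightarrow> ('m \<Rightarrow> 'a \<Rightarrow> 'm) \<Rightarrow> ('m \<Rightarrow> 'a) \<Rightarrow> ('m \<Rightarrow> 'a) \<Rightarrow> bool" where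
  "compatible_O_operator sA sM l r T1 T2 \<longleftrightarrow>
     O_operator sA sM l r T1 \<and> O_operator sA sM l r T2 \<and>
     (\<forall>u v. T1 u * T2 v + T2 u * T1 v
        = T1 (l (T2 u) v + r u (T2 v)) + T2 (l (T1 u) v + r u (T1 v)))"


section \<open>Cochain tuples, staircase differential, cohomology\<close>

text \<open>The direct sum of \<open>N\<close> copies of \<open>H\<close>: tuples \<open>(F 1, \<dots>, F N)\<close>, extended by zero so
  that equality of tuples is equality of functions.\<close>

definition tuples :: "nat \<Rightarrow> 'x::zero set \<Rightarrow> (nat \<Rightarrow> 'x) set" where
  "tuples N H = {F. (\<forall>i\<in>{1..N}. F i \<in> H) \<and> (\<forall>i. i \<notin> {1..N} \<longrightarrow> F i = 0)}"

text \<open>\<open>(b1 (F 1), \<dots>, b1 (F i) + b2 (F (i - 1)), \<dots>, b2 (F N))\<close>, a tuple of length \<open>N + 1\<close>, where \<open>N \<ge> 1\<close>.\<close>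

definition staircase ::
  "('x \<Rightarrow> 'y::comm_monoid_add) \<Rightarrow> ('x \<Rightarrow> 'y) \<Rightarrow> nat \<Rightarrow> (nat \<Rightarrow> 'x) \<Rightarrow> nat \<Rightarrow> 'y" where
  "staircase b1 b2 N F i =
     (if i = 1 then b1 (F 1)
      else if 2 \<le> i \<and> i \<le> N then b1 (F i) + b2 (F (i - 1))
      else if i = N + 1 then b2 (F N)
      else 0)"

text \<open>The quotient of a space \<open>Z\<close> of cocycles by a space \<open>B\<close> of coboundaries, and its vector space
  operations (\<open>s\<close> is the scalar multiplication of cochains).\<close>

definition coh_rel :: "'x::ab_group_add set \<Rightarrow> 'x set \<Rightarrow> ('x \<times> 'x) set" where
  "coh_rel Z B = {(F, G). F \<in> Z \<and> G \<in> Z \<and> F - G \<in> B}"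

definition coh :: "'x::ab_group_add set \<Rightarrow> 'x set \<Rightarrow> 'x set set" where
  "coh Z B = Z // coh_rel Z B"

definition coh_class :: "'x::ab_group_add set \<Rightarrow> 'x set \<Rightarrow> 'x \<Rightarrow> 'x set" where
  "coh_class Z B F = coh_rel Z B `` {F}"

definition coh_add :: "'x::ab_group_add set \<Rightarrow> 'x set \<Rightarrow> 'x set \<Rightarrow> 'x set \<Rightarrow> 'x set" where
  "coh_add Z B X Y = (\<Union>F\<in>X. \<Union>G\<in>Y. coh_class Z B (F + G))"

definition coh_scale ::
  "('k \<Rightarrow> 'x \<Rightarrow> 'x) \<Rightarrow> 'x::ab_group_add set \<Rightarrow> 'x set \<Rightarrow> 'k \<Rightarrow> 'x set \<Rightarrow> 'x set" where
  "coh_scale s Z B c X = (\<Union>F\<in>X. coh_class Z B (s c F))"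

definition coh_linear ::
  "('k \<Rightarrow> 'x \<Rightarrow> 'x) \<Rightarrow> 'x::ab_group_add set \<Rightarrow> 'x set \<Rightarrow>
   ('k \<Rightarrow> 'y \<Rightarrow> 'y) \<Rightarrow> 'y::ab_group_add set \<Rightarrow> 'y set \<Rightarrow> ('x set \<Rightarrow> 'y set) \<Rightarrow> bool" where
  "coh_linear s Z B s' Z' B' \<phi> \<longleftrightarrow>
     \<phi> \<in> coh Z B \<rightarrow> coh Z' B' \<and>
     (\<forall>X\<in>coh Z B. \<forall>Y\<in>coh Z B. \<phi> (coh_add Z B X Y) = coh_add Z' B' (\<phi> X) (\<phi> Y)) \<and>
     (\<forall>c. \<forall>X\<in>coh Z B. \<phi> (coh_scale s Z B c X) = coh_scale s' Z' B' c (\<phi> X))"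


section \<open>Cohomology of a compatible O-operator\<close>

text \<open>An element of \<open>Hom(M^{\<otimes>n}, A)\<close> is a multilinear function of lists of length \<open>n\<close>, extended by
  zero to lists of other lengths.\<close>

definition multilinear ::
  "('k::field \<Rightarrow> 'x::ab_group_add \<Rightarrow> 'x) \<Rightarrow> ('k \<Rightarrow> 'y::ab_group_add \<Rightarrow> 'y) \<Rightarrow> nat \<Rightarrow>
   ('x list \<Rightarrow> 'y) \<Rightarrow> bool" where
  "multilinear sx sy n f \<longleftrightarrow>
     (\<forall>xs i. length xs = n \<longrightarrow> i < n \<longrightarrow> Vector_Spaces.linear sx sy (\<lambda>x. f (xs[i := x])))"

definition Hom ::
  "('k::field \<Rightarrow> 'x::ab_group_add \<Rightarrow> 'x) \<Rightarrow> ('k \<Rightarrow> 'y::ab_group_add \<Rightarrow> 'y) \<Rightarrow> nat \<Rightarrow>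
   ('x list \<Rightarrow> 'y) set" where
  "Hom sx sy n = {f. multilinear sx sy n f \<and> (\<forall>xs. length xs \<noteq> n \<longrightarrow> f xs = 0)}"

text \<open>\<open>[T, a]\<close> for \<open>a \<in> A\<close>, and \<open>[T, f]\<close> for \<open>f \<in> Hom(M^{\<otimes>n}, A)\<close>, \<open>n \<ge> 1\<close>. In the latter \<open>u i\<close> is the
  \<open>i\<close>-th argument, counted from \<open>1\<close>.\<close>

definition bracket0 ::
  "('a::ring \<Rightarrow> 'm::ab_group_add \<Rightarrow> 'm) \<Rightarrow> ('m \<Rightarrow> 'a \<Rightarrow> 'm) \<Rightarrow> ('m \<Rightarrow> 'a) \<Rightarrow> 'a \<Rightarrow> 'm list \<Rightarrow> 'a" where
  "bracket0 l r T a us =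
     (if length us = 1 then
        (let u = us ! 0 in T (l a u - r u a) + T u * a - a * T u)
      else 0)"

definition bracket ::
  "('k::field \<Rightarrow> 'a::ring \<Rightarrow> 'a) \<Rightarrow> ('a \<Rightarrow> 'm::ab_group_add \<Rightarrow> 'm) \<Rightarrow> ('m \<Rightarrow> 'a \<Rightarrow> 'm) \<Rightarrow> ('m \<Rightarrow> 'a) \<Rightarrow>
   nat \<Rightarrow> ('m list \<Rightarrow> 'a) \<Rightarrow> 'm list \<Rightarrow> 'a" where
  "bracket sA l r T n f us =
     (if length us = n + 1 then
        (let u = (\<lambda>i. us ! (i - 1)) in
           T (l (f (take n us)) (u (n + 1)))
         - sA ((-1) ^ n) (T (r (u 1) (f (drop 1 us))))
         - sA ((-1) ^ n)
             ((\<Sum>i = 1..n. sA ((-1) ^ (i - 1))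
                 (f (take (i - 1) us @ [l (T (u i)) (u (i + 1))] @ drop (i + 1) us)))
            - (\<Sum>i = 1..n. sA ((-1) ^ i)
                 (f (take (i - 1) us @ [r (u i) (T (u (i + 1)))] @ drop (i + 1) us))))
         + sA ((-1) ^ n)
             (T (u 1) * f (drop 1 us) - sA ((-1) ^ n) (f (take n us) * T (u (n + 1)))))
      else 0)"

definition C_cO ::
  "('k::field \<Rightarrow> 'a::ring \<Rightarrow> 'a) \<Rightarrow> ('k \<Rightarrow> 'm::ab_group_add \<Rightarrow> 'm) \<Rightarrow> nat \<Rightarrow>
   (nat \<Rightarrow> 'm list \<Rightarrow> 'a) set" where
  "C_cO sA sM n = tuples (n + 1) (Hom sM sA n)"

definition scale_cO ::
  "('k::field \<Rightarrow> 'a::ring \<Rightarrow> 'a) \<Rightarrow> 'k \<Rightarrow> (nat \<Rightarrow> 'm list \<Rightarrow> 'a) \<Rightarrow> nat \<Rightarrow> 'm list \<Rightarrow> 'a" where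
  "scale_cO sA c F = (\<lambda>i us. sA c (F i us))"

definition delta0_cO ::
  "('a::ring \<Rightarrow> 'm::ab_group_add \<Rightarrow> 'm) \<Rightarrow> ('m \<Rightarrow> 'a \<Rightarrow> 'm) \<Rightarrow> ('m \<Rightarrow> 'a) \<Rightarrow> ('m \<Rightarrow> 'a) \<Rightarrow>
   'a \<Rightarrow> nat \<Rightarrow> 'm list \<Rightarrow> 'a" where
  "delta0_cO l r T1 T2 a i =
     (if i = 1 then bracket0 l r T1 a else if i = 2 then bracket0 l r T2 a else 0)"

definition delta_cO ::
  "('k::field \<Rightarrow> 'a::ring \<Rightarrow> 'a) \<Rightarrow> ('a \<Rightarrow> 'm::ab_group_add \<Rightarrow> 'm) \<Rightarrow> ('m \<Rightarrow> 'a \<Rightarrow> 'm) \<Rightarrow>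
   ('m \<Rightarrow> 'a) \<Rightarrow> ('m \<Rightarrow> 'a) \<Rightarrow> nat \<Rightarrow> (nat \<Rightarrow> 'm list \<Rightarrow> 'a) \<Rightarrow> nat \<Rightarrow> 'm list \<Rightarrow> 'a" where
  "delta_cO sA l r T1 T2 n F =
     staircase (bracket sA l r T1 n) (bracket sA l r T2 n) (n + 1) F"

text \<open>Cocycles, coboundaries and cohomology in degrees \<open>n \<ge> 1\<close>. As \<open>C\<^sup>0\<close> is \<open>A\<close> itself,
  the coboundaries of degree \<open>1\<close> are the values of \<open>delta0_cO\<close>.\<close>

definition Z_cO ::
  "('k::field \<Rightarrow> 'a::ring \<Rightarrow> 'a) \<Rightarrow> ('k \<Rightarrow> 'm::ab_group_add \<Rightarrow> 'm) \<Rightarrow>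
   ('a \<Rightarrow> 'm \<Rightarrow> 'm) \<Rightarrow> ('m \<Rightarrow> 'a \<Rightarrow> 'm) \<Rightarrow> ('m \<Rightarrow> 'a) \<Rightarrow> ('m \<Rightarrow> 'a) \<Rightarrow>
   nat \<Rightarrow> (nat \<Rightarrow> 'm list \<Rightarrow> 'a) set" where
  "Z_cO sA sM l r T1 T2 n = {F \<in> C_cO sA sM n. delta_cO sA l r T1 T2 n F = 0}"

definition B_cO ::
  "('k::field \<Rightarrow> 'a::ring \<Rightarrow> 'a) \<Rightarrow> ('k \<Rightarrow> 'm::ab_group_add \<Rightarrow> 'm) \<Rightarrow>
   ('a \<Rightarrow> 'm \<Rightarrow> 'm) \<Rightarrow> ('m \<Rightarrow> 'a \<Rightarrow> 'm) \<Rightarrow> ('m \<Rightarrow> 'a) \<Rightarrow> ('m \<Rightarrow> 'a) \<Rightarrow>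
   nat \<Rightarrow> (nat \<Rightarrow> 'm list \<Rightarrow> 'a) set" where
  "B_cO sA sM l r T1 T2 n =
     (if n = 1 then range (delta0_cO l r T1 T2)
      else delta_cO sA l r T1 T2 (n - 1) ` C_cO sA sM (n - 1))"


section \<open>Compatible dendriform algebras and their cohomology\<close>

definition dendriform ::
  "('k::field \<Rightarrow> 'd::ab_group_add \<Rightarrow> 'd) \<Rightarrow> ('d \<Rightarrow> 'd \<Rightarrow> 'd) \<Rightarrow> ('d \<Rightarrow> 'd \<Rightarrow> 'd) \<Rightarrow> bool" where
  "dendriform s p q \<longleftrightarrow>
     vector_space s \<and> bilinear_map s s s p \<and> bilinear_map s s s q \<and>
     (\<forall>x y z. p (p x y) z = p x (p y z + q y z)) \<and>
     (\<forall>x y z. p (q x y) z = q x (p y z)) \<and>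
     (\<forall>x y z. q (p x y + q x y) z = q x (q y z))"

record 'd dend_ops =
  prec1 :: "'d \<Rightarrow> 'd \<Rightarrow> 'd"
  succ1 :: "'d \<Rightarrow> 'd \<Rightarrow> 'd"
  prec2 :: "'d \<Rightarrow> 'd \<Rightarrow> 'd"
  succ2 :: "'d \<Rightarrow> 'd \<Rightarrow> 'd"

definition compatible_dendriform ::
  "('k::field \<Rightarrow> 'd::ab_group_add \<Rightarrow> 'd) \<Rightarrow> 'd dend_ops \<Rightarrow> bool" where
  "compatible_dendriform s D \<longleftrightarrow>
     dendriform s (prec1 D) (succ1 D) \<and>
     dendriform s (prec2 D) (succ2 D) \<and>
     dendriform s (\<lambda>x y. prec1 D x y + prec2 D x y) (\<lambda>x y. succ1 D x y + succ2 D x y)"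

text \<open>The space \<open>k[C\<^sub>n]\<close>: coefficient functions supported in \<open>{1..n}\<close>, with basis the \<open>symb r\<close>
  for \<open>1 \<le> r \<le> n\<close>, which stand for the symbols \<open>[r]\<close>.\<close>

definition kC :: "nat \<Rightarrow> (nat \<Rightarrow> 'k::field) set" where
  "kC n = {c. \<forall>r. r \<notin> {1..n} \<longrightarrow> c r = 0}"

definition symb :: "nat \<Rightarrow> nat \<Rightarrow> 'k::field" where
  "symb r = (\<lambda>t. if t = r then 1 else 0)"

text \<open>\<open>Hom(k[C\<^sub>n] \<otimes> D^{\<otimes>n}, D)\<close>, extended by zero off \<open>k[C\<^sub>n]\<close> and off the lists of length \<open>n\<close>.\<close>

definition HomC ::
  "('k::field \<Rightarrow> 'd::ab_group_add \<Rightarrow> 'd) \<Rightarrow> nat \<Rightarrow> ((nat \<Rightarrow> 'k) \<Rightarrow> 'd list \<Rightarrow> 'd) set" where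
  "HomC s n = {f.
     (\<forall>c\<in>kC n. f c \<in> Hom s s n) \<and>
     (\<forall>c\<in>kC n. \<forall>c'\<in>kC n. \<forall>xs. f (c + c') xs = f c xs + f c' xs) \<and>
     (\<forall>a. \<forall>c\<in>kC n. \<forall>xs. f (\<lambda>t. a * c t) xs = s a (f c xs)) \<and>
     (\<forall>c xs. c \<notin> kC n \<longrightarrow> f c xs = 0)}"

text \<open>The map on \<open>k[C\<^sub>n] \<otimes> D^{\<otimes>n}\<close> with the prescribed values \<open>f r xs\<close> at \<open>([r]; xs)\<close>.\<close>

definition lin_ext ::
  "('k::field \<Rightarrow> 'd::ab_group_add \<Rightarrow> 'd) \<Rightarrow> nat \<Rightarrow> (nat \<Rightarrow> 'd list \<Rightarrow> 'd) \<Rightarrow>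
   (nat \<Rightarrow> 'k) \<Rightarrow> 'd list \<Rightarrow> 'd" where
  "lin_ext s n f c xs =
     (if c \<in> kC n \<and> length xs = n then \<Sum>r = 1..n. s (c r) (f r xs) else 0)"

text \<open>\<open>R_{m;i,n}\<close> (which does not depend on \<open>m\<close>) acts on indices of symbols; likewise for
  \<open>S_{m;i,n}\<close>, whose values lie in \<open>k[C\<^sub>n]\<close>.\<close>

definition R_map :: "nat \<Rightarrow> nat \<Rightarrow> nat \<Rightarrow> nat" where
  "R_map i n r = (if r \<le> i - 1 then r else if r \<le> i + n - 1 then i else r - n + 1)"

definition S_map :: "nat \<Rightarrow> nat \<Rightarrow> nat \<Rightarrow> nat \<Rightarrow> 'k::field" where
  "S_map i n r =
     (if i \<le> r \<and> r \<le> i + n - 1 then symb (r - i + 1) else \<Sum>t = 1..n. symb t)"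

text \<open>\<open>f \<circ>\<^sub>i g\<close> for \<open>f\<close> of arity \<open>m\<close> and \<open>g\<close> of arity \<open>n\<close>.\<close>

definition circ ::
  "('k::field \<Rightarrow> 'd::ab_group_add \<Rightarrow> 'd) \<Rightarrow> nat \<Rightarrow> nat \<Rightarrow> nat \<Rightarrow>
   ((nat \<Rightarrow> 'k) \<Rightarrow> 'd list \<Rightarrow> 'd) \<Rightarrow> ((nat \<Rightarrow> 'k) \<Rightarrow> 'd list \<Rightarrow> 'd) \<Rightarrow>
   (nat \<Rightarrow> 'k) \<Rightarrow> 'd list \<Rightarrow> 'd" where
  "circ s m n i f g = lin_ext s (m + n - 1) (\<lambda>r xs.
     f (symb (R_map i n r))
       (take (i - 1) xs @ [g (S_map i n r) (take n (drop (i - 1) xs))] @ drop (i + n - 1) xs))"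

definition dbracket ::
  "('k::field \<Rightarrow> 'd::ab_group_add \<Rightarrow> 'd) \<Rightarrow> nat \<Rightarrow> nat \<Rightarrow>
   ((nat \<Rightarrow> 'k) \<Rightarrow> 'd list \<Rightarrow> 'd) \<Rightarrow> ((nat \<Rightarrow> 'k) \<Rightarrow> 'd list \<Rightarrow> 'd) \<Rightarrow>
   (nat \<Rightarrow> 'k) \<Rightarrow> 'd list \<Rightarrow> 'd" where
  "dbracket s m n f g = (\<lambda>c xs.
     (\<Sum>i = 1..m. s ((-1) ^ ((i - 1) * (n - 1))) (circ s m n i f g c xs))
   - s ((-1) ^ ((m - 1) * (n - 1)))
       (\<Sum>i = 1..n. s ((-1) ^ ((i - 1) * (m - 1))) (circ s n m i g f c xs)))"

definition dend_pi ::
  "('k::field \<Rightarrow> 'd::ab_group_add \<Rightarrow> 'd) \<Rightarrow> ('d \<Rightarrow> 'd \<Rightarrow> 'd) \<Rightarrow> ('d \<Rightarrow> 'd \<Rightarrow> 'd) \<Rightarrow>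
   (nat \<Rightarrow> 'k) \<Rightarrow> 'd list \<Rightarrow> 'd" where
  "dend_pi s p q =
     lin_ext s 2 (\<lambda>r xs. if r = 1 then p (xs ! 0) (xs ! 1) else q (xs ! 0) (xs ! 1))"

definition C_cDend ::
  "('k::field \<Rightarrow> 'd::ab_group_add \<Rightarrow> 'd) \<Rightarrow> nat \<Rightarrow> (nat \<Rightarrow> (nat \<Rightarrow> 'k) \<Rightarrow> 'd list \<Rightarrow> 'd) set" where
  "C_cDend s n = tuples n (HomC s n)"

definition scale_cDend ::
  "('k::field \<Rightarrow> 'd::ab_group_add \<Rightarrow> 'd) \<Rightarrow> 'k \<Rightarrow>
   (nat \<Rightarrow> (nat \<Rightarrow> 'k) \<Rightarrow> 'd list \<Rightarrow> 'd) \<Rightarrow> nat \<Rightarrow> (nat \<Rightarrow> 'k) \<Rightarrow> 'd list \<Rightarrow> 'd" where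
  "scale_cDend s a F = (\<lambda>i c xs. s a (F i c xs))"

definition delta_cDend ::
  "('k::field \<Rightarrow> 'd::ab_group_add \<Rightarrow> 'd) \<Rightarrow> 'd dend_ops \<Rightarrow> nat \<Rightarrow>
   (nat \<Rightarrow> (nat \<Rightarrow> 'k) \<Rightarrow> 'd list \<Rightarrow> 'd) \<Rightarrow> nat \<Rightarrow> (nat \<Rightarrow> 'k) \<Rightarrow> 'd list \<Rightarrow> 'd" where
  "delta_cDend s D n F = scale_cDend s ((-1) ^ (n - 1))
     (staircase (dbracket s 2 n (dend_pi s (prec1 D) (succ1 D)))
                (dbracket s 2 n (dend_pi s (prec2 D) (succ2 D))) n F)"

definition Z_cDend ::
  "('k::field \<Rightarrow> 'd::ab_group_add \<Rightarrow> 'd) \<Rightarrow> 'd dend_ops \<Rightarrow> nat \<Rightarrow>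
   (nat \<Rightarrow> (nat \<Rightarrow> 'k) \<Rightarrow> 'd list \<Rightarrow> 'd) set" where
  "Z_cDend s D n = {F \<in> C_cDend s n. delta_cDend s D n F = 0}"

text \<open>The complex starts in degree \<open>1\<close>.\<close>

definition B_cDend ::
  "('k::field \<Rightarrow> 'd::ab_group_add \<Rightarrow> 'd) \<Rightarrow> 'd dend_ops \<Rightarrow> nat \<Rightarrow>
   (nat \<Rightarrow> (nat \<Rightarrow> 'k) \<Rightarrow> 'd list \<Rightarrow> 'd) set" where
  "B_cDend s D n = (if n = 1 then {0} else delta_cDend s D (n - 1) ` C_cDend s (n - 1))"


section \<open>The induced compatible dendriform algebra and the maps \<open>\<Psi>\<^sub>n\<close>\<close>

definition M_Ind ::
  "('a::ring \<Rightarrow> 'm::ab_group_add \<Rightarrow> 'm) \<Rightarrow> ('m \<Rightarrow> 'a \<Rightarrow> 'm) \<Rightarrow> ('m \<Rightarrow> 'a) \<Rightarrow> ('m \<Rightarrow> 'a) \<Rightarrow>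
   'm dend_ops" where
  "M_Ind l r T1 T2 =
     \<lparr>prec1 = (\<lambda>u v. r u (T1 v)), succ1 = (\<lambda>u v. l (T1 u) v),
      prec2 = (\<lambda>u v. r u (T2 v)), succ2 = (\<lambda>u v. l (T2 u) v)\<rparr>"

definition f_Ind ::
  "('k::field \<Rightarrow> 'm::ab_group_add \<Rightarrow> 'm) \<Rightarrow> ('a::ring \<Rightarrow> 'm \<Rightarrow> 'm) \<Rightarrow> ('m \<Rightarrow> 'a \<Rightarrow> 'm) \<Rightarrow>
   nat \<Rightarrow> ('m list \<Rightarrow> 'a) \<Rightarrow> (nat \<Rightarrow> 'k) \<Rightarrow> 'm list \<Rightarrow> 'm" where
  "f_Ind sM l r n f = lin_ext sM (n + 1) (\<lambda>t us.
     if t = 1 then sM ((-1) ^ (n + 1)) (r (us ! 0) (f (drop 1 us)))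
     else if t = n + 1 then l (f (take n us)) (us ! n)
     else 0)"

definition Psi ::
  "('k::field \<Rightarrow> 'm::ab_group_add \<Rightarrow> 'm) \<Rightarrow> ('a::ring \<Rightarrow> 'm \<Rightarrow> 'm) \<Rightarrow> ('m \<Rightarrow> 'a \<Rightarrow> 'm) \<Rightarrow>
   nat \<Rightarrow> (nat \<Rightarrow> 'm list \<Rightarrow> 'a) \<Rightarrow> nat \<Rightarrow> (nat \<Rightarrow> 'k) \<Rightarrow> 'm list \<Rightarrow> 'm" where
  "Psi sM l r n F i = (if i \<in> {1..n + 1} then f_Ind sM l r n (F i) else 0)"

lemma bilinear_map_add:
  assumes "bilinear_map sx sy sz b"
  shows "b (x + x') y = b x y + b x' y" "b x (y + y') = b x y + b x y'"
proof -
  interpret L: Vector_Spaces.linear sy sz "b x" using assms by (simp add: bilinear_map_def)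
  interpret R: Vector_Spaces.linear sx sz "\<lambda>x. b x y" using assms by (simp add: bilinear_map_def)
  show "b (x + x') y = b x y + b x' y" "b x (y + y') = b x y + b x y'"
    using L.add R.add by auto
qed

lemma bilinear_map_comp_left:
  assumes "bilinear_map sx sy sz b" "Vector_Spaces.linear sw sx T"
  shows "bilinear_map sw sy sz (\<lambda>u y. b (T u) y)"
  using assms unfolding bilinear_map_def
  by (auto dest: Vector_Spaces.linear_compose simp: o_def)

lemma bilinear_map_comp_right:
  assumes "bilinear_map sx sy sz b" "Vector_Spaces.linear sw sy U"
  shows "bilinear_map sx sw sz (\<lambda>x u. b x (U u))"
  using assms unfolding bilinear_map_def
  by (auto dest: Vector_Spaces.linear_compose simp: o_def)

lemma M_Ind_compatible_dendriform:
  assumes "bimodule sA sM l r" "compatible_O_operator sA sM l r T1 T2"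
  shows "compatible_dendriform sM (M_Ind l r T1 T2)"
proof -
  interpret bimodule sA sM l r by fact
  note add = bilinear_map_add[OF l_bilinear] bilinear_map_add[OF r_bilinear]
  have lin: "Vector_Spaces.linear sM sA T1" "Vector_Spaces.linear sM sA T2"
    and T1: "\<And>u v. T1 u * T1 v = T1 (l (T1 u) v + r u (T1 v))"
    and T2: "\<And>u v. T2 u * T2 v = T2 (l (T2 u) v + r u (T2 v))"
    and T12: "\<And>u v. T1 u * T2 v + T2 u * T1 v
        = T1 (l (T2 u) v + r u (T2 v)) + T2 (l (T1 u) v + r u (T1 v))"
    using assms(2) by (auto simp: compatible_O_operator_def O_operator_def)
  have T_add: "T1 (u + v) = T1 u + T1 v" "T2 (u + v) = T2 u + T2 v" for u v
    using lin by (auto simp: Vector_Spaces.linear_def module_hom_def module_hom_axioms_def)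
  have dend: "dendriform sM (\<lambda>u v. r u (T v)) (\<lambda>u v. l (T u) v)"
    if T: "Vector_Spaces.linear sM sA T" "\<And>u v. T u * T v = T (l (T u) v + r u (T v))" for T
    unfolding dendriform_def
    using bilinear_map_comp_left[OF l_bilinear T(1)] bilinear_map_comp_right[OF r_bilinear T(1)]
    by (auto simp: M.vector_space_axioms l_r add.commute l_mult[symmetric] r_mult[symmetric] T(2))
  have linT: "Vector_Spaces.linear sM sA (\<lambda>u. T1 u + T2 u)"
  proof -
    interpret f: Vector_Spaces.linear sM sA T1 by fact
    interpret vector_space_pair sM sA by unfold_locales
    show ?thesis by (rule linear_compose_add[OF lin])
  qed
  have "(T1 u + T2 u) * (T1 v + T2 v)
      = T1 (l (T1 u + T2 u) v + r u (T1 v + T2 v)) + T2 (l (T1 u + T2 u) v + r u (T1 v + T2 v))" for u v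
  proof -
    have "(T1 u + T2 u) * (T1 v + T2 v)
       = T1 u * T1 v + T2 u * T2 v + (T1 u * T2 v + T2 u * T1 v)"
      by (simp add: algebra_simps)
    also have "\<dots> = T1 (l (T1 u + T2 u) v + r u (T1 v + T2 v)) + T2 (l (T1 u + T2 u) v + r u (T1 v + T2 v))"
      unfolding T1 T2 T12 by (simp add: add T_add algebra_simps)
    finally show ?thesis .
  qed
  from dend[OF linT this] dend[OF lin(1) T1] dend[OF lin(2) T2]
  show ?thesis
    by (simp add: compatible_dendriform_def M_Ind_def add)
qed

end

theory Submission
  imports Defs
begin

text \<open>Fix a linear map \<open>T: M \<rightarrow> A\<close> and let \<open>\<pi>\<^sub>T\<close> be the pair \<open>u \<cdot> T v\<close>, \<open>T u \<cdot> v\<close> of products on \<open>M\<close>,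
  seen as a 2-cochain. Everything rests on the identity \<open>{{\<pi>\<^sub>T, f\<^bsup>Ind\<^esup>}} = [T, f]\<^bsup>Ind\<^esup>\<close> for \<open>f \<in> Hom(M\<^sup>n, A)\<close>
  (lemma \<open>dbracket_f_Ind\<close>). It is a comparison of values at each symbol \<open>[k]\<close>, \<open>1 \<le> k \<le> n + 2\<close>:
  at \<open>[1]\<close> every term has the form \<open>u\<^sub>1 \<cdot> x\<close>, and the factors \<open>x\<close> add up to \<open>[T, f](u\<^sub>2, \<dots>, u\<^bsub>n+2\<^esub>)\<close>;
  at \<open>[n + 2]\<close> every term has the form \<open>x \<cdot> u\<^bsub>n+2\<^esub>\<close> likewise; at the symbols in between,
  \<open>f\<^bsup>Ind\<^esup>\<close> vanishes on most arguments, and what is left are two pairs of terms that cancel because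
  \<open>(a \<cdot> u) \<cdot> b = a \<cdot> (u \<cdot> b)\<close>.

  Both differentials arrange the brackets with \<open>T\<^sub>1\<close> and \<open>T\<^sub>2\<close> (respectively \<open>\<pi>\<^sub>1\<close> and \<open>\<pi>\<^sub>2\<close>) in the same
  staircase, so the identity, applied to \<open>T\<^sub>1\<close> and to \<open>T\<^sub>2\<close>, shows that \<open>\<Psi>\<close> commutes with the
  differentials up to the sign \<open>(-1)\<^sup>n\<close> which is part of the dendriform differential (\<open>delta_cDend_Psi\<close>).
  Hence \<open>\<Psi>\<close> preserves cocycles, and it preserves coboundaries of degree \<open>n \<ge> 2\<close>. In degree \<open>1\<close> the
  coboundaries come from elements \<open>a \<in> A\<close>, where \<open>\<Psi>\<close> is not defined; there the cochain
  \<open>u \<mapsto> a \<cdot> u - u \<cdot> a\<close> takes the place of the image of \<open>a\<close> (\<open>delta_cDend_commutator\<close>).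
  The rest is linear algebra: a linear map that preserves two subspaces \<open>Z\<close> and \<open>B\<close> induces a linear
  map on the cohomology formed from them (\<open>coh_linear_induced\<close>).\<close>

section \<open>Spaces of cochains and maps induced on cohomology\<close>

text \<open>The scalar multiplications of the cochain spaces are iterates of this one: cochains are
  functions of lists, tuples of cochains are functions of an index.\<close>

abbreviation (input) fun_scale :: "('k \<Rightarrow> 'y \<Rightarrow> 'y) \<Rightarrow> 'k \<Rightarrow> ('x \<Rightarrow> 'y) \<Rightarrow> 'x \<Rightarrow> 'y" where
  "fun_scale s c f \<equiv> (\<lambda>x. s c (f x))"

lemma vector_space_fun_scale:
  assumes "vector_space s"
  shows "vector_space (fun_scale s)"
proof -
  interpret vector_space s by fact
  show ?thesis
    by unfold_locales (auto simp: fun_eq_iff scale_right_distrib scale_left_distrib)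
qed

lemma subspace_tuples:
  assumes "vector_space s" "module.subspace s H"
  shows "module.subspace (fun_scale s) (tuples N H)"
proof -
  interpret vector_space s by fact
  interpret F: vector_space "fun_scale s" by (intro vector_space_fun_scale assms)
  show ?thesis
    using assms(2) by (intro F.subspaceI) (auto simp: tuples_def subspace_0 subspace_add subspace_scale)
qed

lemma linear_staircase:
  assumes "Vector_Spaces.linear s1 s2 b1" "Vector_Spaces.linear s1 s2 b2"
  shows "Vector_Spaces.linear (fun_scale s1) (fun_scale s2) (staircase b1 b2 N)"
proof -
  interpret b1: Vector_Spaces.linear s1 s2 b1 by fact
  interpret b2: Vector_Spaces.linear s1 s2 b2 by fact
  show ?thesis
    unfolding Vector_Spaces.linear_iff
    using b1.vs1.vector_space_axioms b1.vs2.vector_space_axioms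
    by (auto simp: vector_space_fun_scale staircase_def fun_eq_iff b1.add b2.add b1.scale b2.scale
        b1.vs2.scale_right_distrib algebra_simps)
qed

lemma subspace_cocycles:
  assumes "Vector_Spaces.linear s1 s2 d" "module.subspace s1 C"
  shows "module.subspace s1 {F \<in> C. d F = 0}"
proof -
  interpret d: Vector_Spaces.linear s1 s2 d by fact
  show ?thesis
    using d.vs1.subspace_inter[OF assms(2) d.subspace_kernel] by (simp add: Collect_conj_eq)
qed

lemma coh_classD:
  assumes "G \<in> coh_class Z B F"
  shows "G \<in> Z" "F - G \<in> B"
  using assms by (auto simp: coh_class_def coh_rel_def)

context module
begin

lemma mem_coh_class: "subspace B \<Longrightarrow> F \<in> Z \<Longrightarrow> F \<in> coh_class Z B F"
  by (simp add: coh_class_def coh_rel_def subspace_0)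

lemma coh_class_eqI:
  assumes "subspace B" "F - G \<in> B" "F \<in> Z" "G \<in> Z"
  shows "coh_class Z B F = coh_class Z B G"
proof -
  have "F - H \<in> B \<longleftrightarrow> G - H \<in> B" for H
    using subspace_diff[OF assms(1), of "F - H" "F - G"] subspace_add[OF assms(1,2), of "G - H"]
      assms(2)
    by (auto simp: algebra_simps)
  then show ?thesis using assms by (auto simp: coh_class_def coh_rel_def)
qed

lemma coh_add_coh_class:
  assumes Z: "subspace Z" and B: "subspace B" and FG: "F \<in> Z" "G \<in> Z"
  shows "coh_add Z B (coh_class Z B F) (coh_class Z B G) = coh_class Z B (F + G)"
proof -
  have "coh_class Z B (F' + G') = coh_class Z B (F + G)"
    if "F' \<in> coh_class Z B F" "G' \<in> coh_class Z B G" for F' G'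
  proof (rule coh_class_eqI[symmetric, OF B])
    show "F + G - (F' + G') \<in> B"
      using subspace_add[OF B coh_classD(2)[OF that(1)] coh_classD(2)[OF that(2)]]
      by (simp add: algebra_simps)
  qed (use FG that Z in \<open>auto intro: subspace_add dest: coh_classD\<close>)
  then show ?thesis
    unfolding coh_add_def using mem_coh_class[OF B FG(1)] mem_coh_class[OF B FG(2)] by blast
qed

lemma coh_scale_coh_class:
  assumes Z: "subspace Z" and B: "subspace B" and F: "F \<in> Z"
  shows "coh_scale scale Z B c (coh_class Z B F) = coh_class Z B (scale c F)"
proof -
  have "coh_class Z B (scale c F') = coh_class Z B (scale c F)"
    if "F' \<in> coh_class Z B F" for F'
  proof (rule coh_class_eqI[symmetric, OF B])
    show "scale c F - scale c F' \<in> B"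
      using subspace_scale[OF B coh_classD(2)[OF that], of c] by (simp add: scale_right_diff_distrib)
  qed (use F that Z in \<open>auto intro: subspace_scale dest: coh_classD\<close>)
  then show ?thesis
    unfolding coh_scale_def using mem_coh_class[OF B F] by blast
qed

end

text \<open>The operations on \<open>coh Z B\<close> and the induced map are unions over all representatives of a class.
  As \<open>B\<close> is a subspace, all representatives contribute the same class, so each such union
  can be evaluated at one of them.\<close>

lemma coh_linear_induced:
  assumes psi: "Vector_Spaces.linear s s' \<psi>"
    and sub: "module.subspace s Z" "module.subspace s B"
    and sub': "module.subspace s' Z'" "module.subspace s' B'"
    and Z: "\<And>F. F \<in> Z \<Longrightarrow> \<psi> F \<in> Z'"
    and B: "\<And>F. F \<in> B \<Longrightarrow> \<psi> F \<in> B'"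
  shows "\<exists>\<phi>. coh_linear s Z B s' Z' B' \<phi> \<and>
    (\<forall>F\<in>Z. \<phi> (coh_class Z B F) = coh_class Z' B' (\<psi> F))"
proof -
  interpret psi: Vector_Spaces.linear s s' \<psi> by fact
  define \<phi> where "\<phi> X = (\<Union>F\<in>X. coh_class Z' B' (\<psi> F))" for X
  have \<phi>: "\<phi> (coh_class Z B F) = coh_class Z' B' (\<psi> F)" if F: "F \<in> Z" for F
  proof -
    have "coh_class Z' B' (\<psi> F') = coh_class Z' B' (\<psi> F)" if "F' \<in> coh_class Z B F" for F'
    proof (rule psi.vs2.coh_class_eqI[symmetric, OF sub'(2)])
      show "\<psi> F - \<psi> F' \<in> B'"
        using B coh_classD(2)[OF that] by (simp flip: psi.diff)
    qed (use Z F coh_classD(1)[OF that] in auto)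
    then show ?thesis
      unfolding \<phi>_def using psi.vs1.mem_coh_class[OF sub(2) F] by blast
  qed
  have cohE: "\<exists>F\<in>Z. X = coh_class Z B F" if "X \<in> coh Z B" for X
    using that by (auto simp: coh_def quotient_def coh_class_def)
  have cohI: "coh_class Z' B' F \<in> coh Z' B'" if "F \<in> Z'" for F
    using that by (auto simp: coh_def quotient_def coh_class_def)
  have "coh_linear s Z B s' Z' B' \<phi>"
    unfolding coh_linear_def
  proof (intro conjI ballI allI Pi_I)
    fix X assume "X \<in> coh Z B"
    then obtain F where F: "F \<in> Z" "X = coh_class Z B F" using cohE by blast
    then show "\<phi> X \<in> coh Z' B'" by (simp add: \<phi> Z cohI)
    show "\<phi> (coh_scale s Z B c X) = coh_scale s' Z' B' c (\<phi> X)" for c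
      using F by (simp add: psi.vs1.coh_scale_coh_class[OF sub] psi.vs2.coh_scale_coh_class[OF sub']
          \<phi> Z psi.vs1.subspace_scale[OF sub(1)] psi.scale)
    fix Y assume "Y \<in> coh Z B"
    then obtain G where G: "G \<in> Z" "Y = coh_class Z B G" using cohE by blast
    show "\<phi> (coh_add Z B X Y) = coh_add Z' B' (\<phi> X) (\<phi> Y)"
      using F G by (simp add: psi.vs1.coh_add_coh_class[OF sub] psi.vs2.coh_add_coh_class[OF sub']
          \<phi> Z psi.vs1.subspace_add[OF sub(1)] psi.add)
  qed
  with \<phi> show ?thesis by blast
qed

section \<open>Cochains on symbols and the bracket with a dendriform structure\<close>

lemma symb_in_kC: "k \<in> {1..n} \<Longrightarrow> symb k \<in> kC n"
  by (auto simp: symb_def kC_def)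

lemma sum_symb_eq: "(\<Sum>t = 1..n. symb t) = (\<lambda>t. if t \<in> {1..n} then 1 else (0 :: 'k::field))"
proof
  fix t
  have "(\<Sum>t = 1..n. symb t) t = (\<Sum>i = 1..n. symb i t :: 'k)"
    by (induction n) auto
  then show "(\<Sum>t = 1..n. symb t) t = (if t \<in> {1..n} then 1 else (0 :: 'k))"
    by (simp add: symb_def)
qed

lemma sum_symb_in_kC: "(\<Sum>t = 1..n. symb t) \<in> kC n"
  unfolding sum_symb_eq by (auto simp: kC_def)

text \<open>Additivity in one slot, with the slot marked by its left and right neighbours as in the
  insertions of products into the arguments.\<close>

lemma Hom_slot_add:
  assumes "f \<in> Hom sx sy n" "length xs + length ys + 1 = n"
  shows "f (xs @ [x + x'] @ ys) = f (xs @ [x] @ ys) + f (xs @ [x'] @ ys)"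
proof -
  have "Vector_Spaces.linear sx sy (\<lambda>x. f ((xs @ [0] @ ys)[length xs := x]))"
    using assms(1) assms(2)[symmetric] unfolding Hom_def multilinear_def
    by (auto dest!: spec[of _ "xs @ [0] @ ys"] spec[of _ "length xs"])
  then show ?thesis by (simp add: Vector_Spaces.linear_iff list_update_append)
qed

text \<open>The values of \<open>{{\<pi>, g}}\<close> at the symbols \<open>[k]\<close>, for \<open>\<pi>\<close> given by two products \<open>p\<close> and \<open>q\<close> and \<open>g\<close> of
  arity \<open>n\<close>. The shape is that of a Hochschild coboundary for the product \<open>x * y = p x y + q x y\<close>,
  except that the symbol decides which part of \<open>*\<close> is used: the inserted product is cut down
  to \<open>p\<close> or \<open>q\<close> only if \<open>k\<close> points at one of its two factors (\<open>k = i\<close> or \<open>k = i + 1\<close>).\<close>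

definition dend_coboundary ::
  "('k::field \<Rightarrow> 'd::ab_group_add \<Rightarrow> 'd) \<Rightarrow> ('d \<Rightarrow> 'd \<Rightarrow> 'd) \<Rightarrow> ('d \<Rightarrow> 'd \<Rightarrow> 'd) \<Rightarrow> nat \<Rightarrow>
   ((nat \<Rightarrow> 'k) \<Rightarrow> 'd list \<Rightarrow> 'd) \<Rightarrow> nat \<Rightarrow> 'd list \<Rightarrow> 'd"
  where
  "dend_coboundary s p q n g k xs =
     (if k \<le> n then p (g (symb k) (take n xs)) (xs ! n)
      else q (g (\<Sum>t = 1..n. symb t) (take n xs)) (xs ! n))
   + s ((-1) ^ (n - 1))
       (if k = 1 then p (xs ! 0) (g (\<Sum>t = 1..n. symb t) (drop 1 xs))
        else q (xs ! 0) (g (symb (k - 1)) (drop 1 xs)))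
   - s ((-1) ^ (n - 1)) (\<Sum>i = 1..n. s ((-1) ^ (i - 1))
       (g (symb (R_map i 2 k))
         (take (i - 1) xs
          @ [(if k \<noteq> i + 1 then p (xs ! (i - 1)) (xs ! i) else 0)
             + (if k \<noteq> i then q (xs ! (i - 1)) (xs ! i) else 0)]
          @ drop (i + 1) xs)))"

context vector_space
begin

lemma vector_space_fun_scale2: "vector_space (fun_scale (fun_scale scale))"
  by (intro vector_space_fun_scale vector_space_axioms)

lemma lin_ext_symb:
  assumes "k \<in> {1..n}" "length xs = n"
  shows "lin_ext scale n f (symb k) xs = f k xs"
proof -
  have "(\<Sum>r = 1..n. scale (symb k r) (f r xs)) = (\<Sum>r = 1..n. if r = k then f r xs else 0)"
    by (intro sum.cong) (auto simp: symb_def)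
  also have "\<dots> = f k xs"
    using assms by simp
  finally show ?thesis using assms by (simp add: lin_ext_def symb_in_kC)
qed

lemma lin_ext_sum_symb:
  assumes "length xs = n"
  shows "lin_ext scale n f (\<Sum>t = 1..n. symb t) xs = (\<Sum>r = 1..n. f r xs)"
proof -
  have "lin_ext scale n f (\<Sum>t = 1..n. symb t) xs
      = (\<Sum>r = 1..n. scale ((\<Sum>t = 1..n. symb t) r) (f r xs))"
    using assms by (simp add: lin_ext_def sum_symb_in_kC[simplified])
  then show ?thesis unfolding sum_symb_eq by simp
qed

lemma lin_ext_cong:
  assumes "\<And>k xs. k \<in> {1..n} \<Longrightarrow> length xs = n \<Longrightarrow> f k xs = g k xs"
  shows "lin_ext scale n f = lin_ext scale n g"
  using assms by (auto simp: lin_ext_def fun_eq_iff intro!: sum.cong)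

lemma lin_ext_add:
  "lin_ext scale n (\<lambda>k xs. f k xs + g k xs) = lin_ext scale n f + lin_ext scale n g"
  by (auto simp: lin_ext_def fun_eq_iff scale_right_distrib sum.distrib)

lemma lin_ext_diff:
  "lin_ext scale n (\<lambda>k xs. f k xs - g k xs) c xs = lin_ext scale n f c xs - lin_ext scale n g c xs"
  by (auto simp: lin_ext_def fun_eq_iff scale_right_diff_distrib sum_subtractf)

lemma lin_ext_scale:
  "lin_ext scale n (\<lambda>k xs. scale a (f k xs)) c xs = scale a (lin_ext scale n f c xs)"
  by (auto simp: lin_ext_def fun_eq_iff scale_sum_right mult.commute)

lemma lin_ext_sum:
  "lin_ext scale n (\<lambda>k xs. \<Sum>i\<in>I. f i k xs) c xs = (\<Sum>i\<in>I. lin_ext scale n (f i) c xs)"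
  by (auto simp: lin_ext_def fun_eq_iff scale_sum_right intro: sum.swap)

lemma subspace_Hom:
  assumes "vector_space s"
  shows "module.subspace (fun_scale scale) (Hom s scale n)"
proof -
  interpret V: vector_space s by fact
  interpret vector_space_pair s scale ..
  interpret F: vector_space "fun_scale scale" by (intro vector_space_fun_scale vector_space_axioms)
  show ?thesis
    by (intro F.subspaceI)
      (auto simp: Hom_def multilinear_def linear_zero linear_compose_add linear_compose_scale_right)
qed

lemma lin_ext_in_HomC:
  assumes "\<And>k. k \<in> {1..n} \<Longrightarrow> multilinear scale scale n (f k)"
  shows "lin_ext scale n f \<in> HomC scale n"
proof -
  interpret vector_space_pair scale scale ..
  have "multilinear scale scale n (\<lambda>xs. lin_ext scale n f c xs)" if "c \<in> kC n" for c
    using assms that unfolding multilinear_def lin_ext_def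
    by (auto intro!: linear_compose_sum linear_compose_scale_right)
  then show ?thesis
    by (auto simp: HomC_def Hom_def)
       (auto simp: lin_ext_def kC_def scale_left_distrib sum.distrib scale_sum_right)
qed

lemma subspace_HomC: "module.subspace (fun_scale (fun_scale scale)) (HomC scale n)"
proof -
  interpret F: vector_space "fun_scale scale" by (intro vector_space_fun_scale vector_space_axioms)
  interpret G: vector_space "fun_scale (fun_scale scale)"
    by (intro vector_space_fun_scale F.vector_space_axioms)
  have H: "module.subspace (fun_scale scale) (Hom scale scale n)"
    by (rule subspace_Hom) unfold_locales
  show ?thesis
  proof (intro G.subspaceI)
    show "0 \<in> HomC scale n"
      using F.subspace_0[OF H] by (auto simp: HomC_def)
    show "f + g \<in> HomC scale n" if "f \<in> HomC scale n" "g \<in> HomC scale n" for f g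
      using that F.subspace_add[OF H] by (auto simp: HomC_def scale_right_distrib algebra_simps)
    show "fun_scale (fun_scale scale) a f \<in> HomC scale n" if "f \<in> HomC scale n" for a f
      using that F.subspace_scale[OF H] by (auto simp: HomC_def scale_right_distrib mult.commute)
  qed
qed

lemma dend_pi_symb:
  "dend_pi scale p q (symb 1) [x, y] = p x y"
  "dend_pi scale p q (symb 2) [x, y] = q x y"
  "dend_pi scale p q (\<Sum>t = 1..2. symb t) [x, y] = p x y + q x y"
  unfolding dend_pi_def
  by (subst lin_ext_symb lin_ext_sum_symb; simp add: numeral_2_eq_2)+

text \<open>Writing the bracket as the linear extension of its values at symbols makes its linearity in \<open>g\<close>
  visible and reduces identities of cochains to the symbols, one at a time.\<close>

lemma dbracket_dend_pi:
  assumes "n \<ge> 1"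
  shows "dbracket scale 2 n (dend_pi scale p q) g = lin_ext scale (n + 1) (dend_coboundary scale p q n g)"
proof (intro ext)
  fix c xs
  let ?\<pi> = "dend_pi scale p q"
  have ivl: "{1..2::nat} = {1, 2}" by auto
  have take2: "take 2 (drop (i - 1) ys) = [ys ! (i - 1), ys ! i]"
    if "i \<in> {1..n}" "length ys = n + 1" for i and ys :: "'b list"
    using that by (intro nth_equalityI) (auto simp: nth_Cons split: nat.split)
  have dropn: "drop n ys = [ys ! n]" if "length ys = n + 1" for ys :: "'b list"
    using that by (intro nth_equalityI) auto
  have take1: "take 1 ys = [ys ! 0]" if "length ys = n + 1" for ys :: "'b list"
    using that by (cases ys) auto
  have g_pi: "circ scale n 2 i g ?\<pi> = lin_ext scale (n + 1) (\<lambda>k xs.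
       g (symb (R_map i 2 k))
         (take (i - 1) xs
          @ [(if k \<noteq> i + 1 then p (xs ! (i - 1)) (xs ! i) else 0)
             + (if k \<noteq> i then q (xs ! (i - 1)) (xs ! i) else 0)]
          @ drop (i + 1) xs))" if i: "i \<in> {1..n}" for i
  proof -
    have "?\<pi> (S_map i 2 k) [x, y] = (if k \<noteq> i + 1 then p x y else 0) + (if k \<noteq> i then q x y else 0)"
      for k x y
      using i by (auto simp: S_map_def dend_pi_symb[simplified] numeral_2_eq_2[symmetric])
    then show ?thesis
      unfolding circ_def using i by (simp, intro lin_ext_cong) (simp add: take2[simplified])
  qed
  have pi_g1: "circ scale 2 n 1 ?\<pi> g = lin_ext scale (n + 1) (\<lambda>k xs.
      if k \<le> n then p (g (symb k) (take n xs)) (xs ! n)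
      else q (g (\<Sum>t = 1..n. symb t) (take n xs)) (xs ! n))"
    unfolding circ_def using assms
    by (simp, intro lin_ext_cong)
       (auto simp: R_map_def S_map_def dropn le_Suc_eq dend_pi_symb[simplified] numeral_2_eq_2[symmetric])
  have pi_g2: "circ scale 2 n 2 ?\<pi> g = lin_ext scale (n + 1) (\<lambda>k xs.
      if k = 1 then p (xs ! 0) (g (\<Sum>t = 1..n. symb t) (drop 1 xs))
      else q (xs ! 0) (g (symb (k - 1)) (drop 1 xs)))"
  proof -
    have "Suc (k - 2) = k - 1" if "k \<ge> 1" "k \<noteq> 1" for k :: nat
      using that by simp
    then show ?thesis
      unfolding circ_def using assms
      by (simp, intro lin_ext_cong)
         (auto simp: R_map_def S_map_def take1[simplified] dend_pi_symb[simplified]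
            numeral_2_eq_2[symmetric])
  qed
  show "dbracket scale 2 n ?\<pi> g c xs = lin_ext scale (n + 1) (dend_coboundary scale p q n g) c xs"
    unfolding dbracket_def dend_coboundary_def[abs_def] ivl
    by (simp add: pi_g1[simplified] pi_g2[simplified] g_pi[simplified] lin_ext_add lin_ext_diff lin_ext_scale lin_ext_sum)
qed

lemma linear_lin_ext_comp:
  assumes "Vector_Spaces.linear s1 (fun_scale (fun_scale scale)) h"
  shows "Vector_Spaces.linear s1 (fun_scale (fun_scale scale)) (\<lambda>g. lin_ext scale n (h g))"
proof -
  interpret h: Vector_Spaces.linear s1 "fun_scale (fun_scale scale)" h by fact
  show ?thesis
    unfolding Vector_Spaces.linear_iff
    using h.vs1.vector_space_axioms h.vs2.vector_space_axioms
    by (auto simp: h.add h.scale fun_eq_iff lin_ext_scale vector_space_fun_scale2)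
       (auto simp: lin_ext_def scale_right_distrib sum.distrib)
qed

lemma linear_dbracket_dend_pi:
  assumes "bilinear_map scale scale scale p" "bilinear_map scale scale scale q" "n \<ge> 1"
  shows "Vector_Spaces.linear (fun_scale (fun_scale scale)) (fun_scale (fun_scale scale))
           (dbracket scale 2 n (dend_pi scale p q))"
proof -
  have "Vector_Spaces.linear (fun_scale (fun_scale scale)) (fun_scale (fun_scale scale))
      (dend_coboundary scale p q n)"
  proof -
    have sc: "p (scale c x) y = scale c (p x y)" "p x (scale c y) = scale c (p x y)"
      "q (scale c x) y = scale c (q x y)" "q x (scale c y) = scale c (q x y)" for c x y
      using assms by (auto simp: bilinear_map_def Vector_Spaces.linear_iff)
    show ?thesis
      unfolding Vector_Spaces.linear_iff
      by (auto simp: vector_space_fun_scale2 dend_coboundary_def fun_eq_iff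
          bilinear_map_add[OF assms(1)] bilinear_map_add[OF assms(2)] sc
          scale_right_distrib scale_right_diff_distrib sum.distrib scale_sum_right mult.commute mult.left_commute)
  qed
  then show ?thesis
    using linear_lin_ext_comp by (simp add: dbracket_dend_pi[OF assms(3), abs_def])
qed

end

section \<open>The chain map\<close>

context bimodule
begin

lemma linear_actions:
  "Vector_Spaces.linear sM sM (l a)" "Vector_Spaces.linear sA sM (\<lambda>a. l a u)"
  "Vector_Spaces.linear sA sM (r u)" "Vector_Spaces.linear sM sM (\<lambda>u. r u a)"
  "Vector_Spaces.linear sA sA ((*) a)" "Vector_Spaces.linear sA sA (\<lambda>a. a * b)"
  using l_bilinear r_bilinear A.mult_bilinear by (auto simp: bilinear_map_def)

lemmas actions_add =
  linear_actions[THEN Vector_Spaces.linear_iff[THEN iffD1], THEN conjunct2, THEN conjunct2,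
    THEN conjunct1, rule_format]
lemmas actions_scale =
  linear_actions[THEN Vector_Spaces.linear_iff[THEN iffD1], THEN conjunct2, THEN conjunct2,
    THEN conjunct2, rule_format]
lemmas actions_diff =
  linear_actions[unfolded Vector_Spaces.linear_def, THEN conjunct2, THEN conjunct2, THEN module_hom.diff]
lemmas actions_sum =
  linear_actions[unfolded Vector_Spaces.linear_def, THEN conjunct2, THEN conjunct2, THEN module_hom.sum]
lemmas actions_minus =
  linear_actions[unfolded Vector_Spaces.linear_def, THEN conjunct2, THEN conjunct2, THEN module_hom.neg]
lemmas actions_zero =
  linear_actions[unfolded Vector_Spaces.linear_def, THEN conjunct2, THEN conjunct2, THEN module_hom.zero]


lemma sign_scale:
  "sA ((-1) ^ n) a = (if even n then a else - a)" "sM ((-1) ^ n) u = (if even n then u else - u)"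
  by (auto simp: minus_one_power_iff)

lemma linear_bracket:
  assumes T: "Vector_Spaces.linear sM sA T"
  shows "Vector_Spaces.linear (fun_scale sA) (fun_scale sA) (bracket sA l r T n)"
proof -
  interpret T: Vector_Spaces.linear sM sA T by fact
  show ?thesis
    unfolding Vector_Spaces.linear_iff
    by (auto simp: vector_space_fun_scale A.vector_space_axioms bracket_def fun_eq_iff Let_def
        actions_add actions_scale T.add T.scale A.scale_right_distrib A.scale_right_diff_distrib
        sum.distrib A.scale_sum_right algebra_simps)
qed

lemma linear_bracket0:
  assumes T: "Vector_Spaces.linear sM sA T"
  shows "Vector_Spaces.linear sA (fun_scale sA) (bracket0 l r T)"
proof -
  interpret T: Vector_Spaces.linear sM sA T by fact
  show ?thesis
    unfolding Vector_Spaces.linear_iff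
    by (auto simp: vector_space_fun_scale A.vector_space_axioms bracket0_def fun_eq_iff Let_def
        actions_add actions_scale actions_diff T.add T.diff T.scale
        A.scale_right_diff_distrib algebra_simps)
qed

text \<open>The two alternating sums of the bracket have opposite signs termwise, so by additivity
  of \<open>f\<close> they merge into one sum, whose terms contain the total product \<open>u \<cdot> T v + T u \<cdot> v\<close>, as in
  \<open>dend_coboundary\<close>.\<close>

lemma bracket_eq:
  assumes f: "f \<in> Hom sM sA n" and us: "length us = n + 1"
  shows "bracket sA l r T n f us =
      T (l (f (take n us)) (us ! n)) - sA ((-1) ^ n) (T (r (us ! 0) (f (drop 1 us))))
    - sA ((-1) ^ n) (\<Sum>i = 1..n. sA ((-1) ^ (i - 1))
        (f (take (i - 1) us @ [r (us ! (i - 1)) (T (us ! i)) + l (T (us ! (i - 1))) (us ! i)]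
            @ drop (i + 1) us)))
    + sA ((-1) ^ n) (T (us ! 0) * f (drop 1 us)) - f (take n us) * T (us ! n)"
proof -
  have sum_eq: "(\<Sum>i = 1..n. sA ((-1) ^ (i - 1))
        (f (take (i - 1) us @ [l (T (us ! (i - 1))) (us ! (i + 1 - 1))] @ drop (i + 1) us)))
      - (\<Sum>i = 1..n. sA ((-1) ^ i)
        (f (take (i - 1) us @ [r (us ! (i - 1)) (T (us ! (i + 1 - 1)))] @ drop (i + 1) us)))
      = (\<Sum>i = 1..n. sA ((-1) ^ (i - 1))
        (f (take (i - 1) us @ [r (us ! (i - 1)) (T (us ! i)) + l (T (us ! (i - 1))) (us ! i)]
            @ drop (i + 1) us)))"
    unfolding sum_subtractf[symmetric]
  proof (intro sum.cong refl)
    fix i assume i: "i \<in> {1..n}"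
    then have "(-1 :: 'k) ^ i = - ((-1) ^ (i - 1))"
      by (cases i) auto
    moreover have "length (take (i - 1) us) + length (drop (i + 1) us) + 1 = n"
      using i us by auto
    ultimately show "sA ((-1) ^ (i - 1))
          (f (take (i - 1) us @ [l (T (us ! (i - 1))) (us ! (i + 1 - 1))] @ drop (i + 1) us))
        - sA ((-1) ^ i)
          (f (take (i - 1) us @ [r (us ! (i - 1)) (T (us ! (i + 1 - 1)))] @ drop (i + 1) us))
        = sA ((-1) ^ (i - 1))
        (f (take (i - 1) us @ [r (us ! (i - 1)) (T (us ! i)) + l (T (us ! (i - 1))) (us ! i)]
            @ drop (i + 1) us))"
      unfolding Hom_slot_add[OF f \<open>_ = n\<close>] by (simp add: A.scale_right_distrib)
  qed
  have "sA ((-1) ^ n) (x - sA ((-1) ^ n) y) = sA ((-1) ^ n) x - y" for x y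
    by (auto simp: sign_scale)
  with us show ?thesis
    unfolding bracket_def Let_def sum_eq by simp
qed

lemma f_Ind_symb:
  assumes "length us = n + 1" "k \<in> {1..n + 1}"
  shows "f_Ind sM l r n f (symb k) us =
    (if k = 1 then sM ((-1) ^ (n + 1)) (r (us ! 0) (f (drop 1 us)))
     else if k = n + 1 then l (f (take n us)) (us ! n) else 0)"
  unfolding f_Ind_def using assms by (subst M.lin_ext_symb) auto

lemma f_Ind_sum_symb:
  assumes "length us = n + 1" "n \<ge> 1"
  shows "f_Ind sM l r n f (\<Sum>t = 1..n + 1. symb t) us =
    sM ((-1) ^ (n + 1)) (r (us ! 0) (f (drop 1 us))) + l (f (take n us)) (us ! n)"
proof -
  have "(\<Sum>k = 1..n + 1. if k = 1 then x else if k = n + 1 then y else 0) = x + y" for x y :: 'm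
  proof -
    have "(if k = 1 then x else if k = n + 1 then y else 0)
        = (if k = 1 then x else 0) + (if k = n + 1 then y else 0)" for k
      using assms by auto
    then show ?thesis by (simp add: sum.distrib)
  qed
  then show ?thesis
    unfolding f_Ind_def using assms by (subst M.lin_ext_sum_symb) auto
qed

lemma linear_f_Ind:
  "Vector_Spaces.linear (fun_scale sA) (fun_scale (fun_scale sM)) (f_Ind sM l r n)"
proof -
  have "Vector_Spaces.linear (fun_scale sA) (fun_scale (fun_scale sM)) (\<lambda>f t us.
     if t = 1 then sM ((-1) ^ (n + 1)) (r (us ! 0) (f (drop 1 us)))
     else if t = n + 1 then l (f (take n us)) (us ! n)
     else 0)"
    unfolding Vector_Spaces.linear_iff
    by (auto simp: vector_space_fun_scale A.vector_space_axioms M.vector_space_fun_scale2 fun_eq_iff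
        actions_add actions_scale M.scale_right_distrib mult.commute)
  then show ?thesis
    unfolding f_Ind_def[abs_def] by (rule M.linear_lin_ext_comp)
qed

lemma f_Ind_in_HomC:
  assumes f: "f \<in> Hom sM sA n"
  shows "f_Ind sM l r n f \<in> HomC sM (n + 1)"
proof -
  have lin: "Vector_Spaces.linear sM sA (\<lambda>x. f (xs[i := x]))" if "length xs = n" "i < n" for xs i
    using f that by (auto simp: Hom_def multilinear_def)
  interpret MM: vector_space_pair sM sM ..
  have first: "multilinear sM sM (n + 1) (\<lambda>us. r (us ! 0) (f (drop 1 us)))"
    unfolding multilinear_def
  proof (intro allI impI)
    fix xs :: "'m list" and i assume *: "length xs = n + 1" "i < n + 1"
    show "Vector_Spaces.linear sM sM (\<lambda>x. r (xs[i := x] ! 0) (f (drop 1 (xs[i := x]))))"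
    proof (cases i)
      case 0
      then show ?thesis using * linear_actions(4) by simp
    next
      case (Suc j)
      have "drop 1 (xs[i := x]) = (drop 1 xs)[j := x]" for x
        using Suc * by (cases xs) auto
      then show ?thesis
        using Vector_Spaces.linear_compose[OF lin[of "drop 1 xs" j] linear_actions(3)[of "xs ! 0"]] * Suc
        by (simp add: o_def)
    qed
  qed
  have last: "multilinear sM sM (n + 1) (\<lambda>us. l (f (take n us)) (us ! n))"
    unfolding multilinear_def
  proof (intro allI impI)
    fix xs :: "'m list" and i assume *: "length xs = n + 1" "i < n + 1"
    show "Vector_Spaces.linear sM sM (\<lambda>x. l (f (take n (xs[i := x]))) (xs[i := x] ! n))"
    proof (cases "i = n")
      case True
      then show ?thesis using * linear_actions(1) by simp
    next
      case False
      then show ?thesis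
        using Vector_Spaces.linear_compose[OF lin[of "take n xs" i] linear_actions(2)[of "xs ! n"]] *
        by (simp add: o_def take_update_swap)
    qed
  qed
  have "multilinear sM sM (n + 1) (\<lambda>us. sM ((-1) ^ (n + 1)) (r (us ! 0) (f (drop 1 us))))"
    using first unfolding multilinear_def by (intro allI impI MM.linear_compose_scale_right) auto
  moreover have "multilinear sM sM (n + 1) (\<lambda>us. 0)"
    by (simp add: multilinear_def MM.linear_zero)
  ultimately show ?thesis
    unfolding f_Ind_def using last
    by (intro M.lin_ext_in_HomC, rename_tac k, case_tac "k = 1"; case_tac "k = n + 1"; simp)
qed

text \<open>The key identity. Below, \<open>G i\<close> is \<open>f\<^bsup>Ind\<^esup>\<close> with the \<open>i\<close>-th and \<open>(i + 1)\<close>-st argument multiplied, and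
  \<open>w i\<close> is their total product. The inserted product is the total one except when \<open>k\<close> points at one of
  its factors; at \<open>[1]\<close> this concerns only \<open>G 1\<close>, at \<open>[n + 2]\<close> only \<open>G (n + 1)\<close>.\<close>

lemma dbracket_f_Ind:
  assumes T: "Vector_Spaces.linear sM sA T" and f: "f \<in> Hom sM sA n" and n: "n \<ge> 1"
  shows "dbracket sM 2 (n + 1) (dend_pi sM (\<lambda>u v. r u (T v)) (\<lambda>u v. l (T u) v)) (f_Ind sM l r n f)
       = f_Ind sM l r (n + 1) (bracket sA l r T n f)"
proof -
  interpret T: Vector_Spaces.linear sM sA T by fact
  let ?p = "\<lambda>u v. r u (T v)" and ?q = "\<lambda>u v. l (T u) v"
  let ?g = "f_Ind sM l r n f"
  have "dend_coboundary sM ?p ?q (n + 1) ?g k us =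
      (if k = 1 then sM ((-1) ^ (n + 1 + 1)) (r (us ! 0) (bracket sA l r T n f (drop 1 us)))
       else if k = n + 1 + 1 then l (bracket sA l r T n f (take (n + 1) us)) (us ! (n + 1))
       else 0)"
    if k: "k \<in> {1..n + 2}" and us: "length us = n + 2" for k us
  proof -
    define w where "w i = r (us ! (i - 1)) (T (us ! i)) + l (T (us ! (i - 1))) (us ! i)" for i
    define G where "G i = ?g (symb (R_map i 2 k)) (take (i - 1) us
        @ [(if k \<noteq> i + 1 then ?p (us ! (i - 1)) (us ! i) else 0)
           + (if k \<noteq> i then ?q (us ! (i - 1)) (us ! i) else 0)]
        @ drop (i + 1) us)" for i
    have cob: "dend_coboundary sM ?p ?q (n + 1) ?g k us =
       (if k \<le> n + 1 then ?p (?g (symb k) (take (n + 1) us)) (us ! (n + 1))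
        else ?q (?g (\<Sum>t = 1..n + 1. symb t) (take (n + 1) us)) (us ! (n + 1)))
     + sM ((-1) ^ n)
         (if k = 1 then ?p (us ! 0) (?g (\<Sum>t = 1..n + 1. symb t) (drop 1 us))
          else ?q (us ! 0) (?g (symb (k - 1)) (drop 1 us)))
     - sM ((-1) ^ n) (\<Sum>i = 1..n + 1. sM ((-1) ^ (i - 1)) (G i))"
      unfolding dend_coboundary_def G_def by simp
    have sumG: "(\<Sum>i = 1..n + 1. sM ((-1) ^ (i - 1)) (G i)) = G 1 + (\<Sum>j = 1..n. sM ((-1) ^ j) (G (Suc j)))"
      by (simp add: sum.atLeast_Suc_atMost sum.shift_bounds_cl_Suc_ivl del: sum.cl_ivl_Suc)
    consider "k = 1" | "k = n + 2" | "k \<in> {2..n + 1}" using k by force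
    then show ?thesis
    proof cases
      case 1
      (* In G 1 the part u1.T(u2) is inserted; it yields u1.(T(u2) f(u3, ...)), the term of the
         bracket that multiplies by T from the left. The other G i yield the terms of its sum. *)
      have G1: "G 1 = sM ((-1) ^ (n + 1)) (r (us ! 0) (T (us ! 1) * f (drop 2 us)))"
        unfolding G_def using 1 us n
        by (simp add: R_map_def f_Ind_symb[simplified] r_mult numeral_2_eq_2)
      have Gj: "G (Suc j) = sM ((-1) ^ (n + 1))
          (r (us ! 0) (f (take (j - 1) (drop 1 us) @ [w (Suc j)] @ drop (j + 1) (drop 1 us))))"
        if "j \<in> {1..n}" for j
      proof -
        have "length (take j us @ w (Suc j) # drop (Suc (Suc j)) us) = n + 1"
          using us that by simp
        moreover have "take j us = us ! 0 # take (j - 1) (drop 1 us)"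
          using us that by (cases us; cases j) auto
        ultimately show ?thesis
          unfolding G_def using that 1 us n
          by (simp add: R_map_def f_Ind_symb[simplified] w_def)
      qed
      define S where "S = (\<Sum>j = 1..n. sA ((-1) ^ (j - 1))
            (f (take (j - 1) (drop 1 us) @ [w (Suc j)] @ drop (j + 1) (drop 1 us))))"
      have B: "bracket sA l r T n f (drop 1 us) =
          T (l (f (take n (drop 1 us))) (us ! (n + 1)))
        - sA ((-1) ^ n) (T (r (us ! 1) (f (drop 2 us))))
        - sA ((-1) ^ n) S
        + sA ((-1) ^ n) (T (us ! 1) * f (drop 2 us))
        - f (take n (drop 1 us)) * T (us ! (n + 1))"
      proof -
        have nth: "drop 1 us ! j = us ! Suc j" for j
          using us by simp
        have "S = (\<Sum>j = 1..n. sA ((-1) ^ (j - 1)) (f (take (j - 1) (drop 1 us)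
            @ [r (drop 1 us ! (j - 1)) (T (drop 1 us ! j)) + l (T (drop 1 us ! (j - 1))) (drop 1 us ! j)]
            @ drop (j + 1) (drop 1 us))))"
          unfolding S_def w_def nth by (intro sum.cong refl) auto
        moreover have "drop 1 (drop 1 us) = drop 2 us"
          by (simp add: numeral_2_eq_2)
        ultimately show ?thesis
          using us by (subst bracket_eq[OF f]) (auto simp: nth)
      qed
      have "sM ((-1) ^ j) (G (Suc j)) = sM ((-1) ^ n) (r (us ! 0) (sA ((-1) ^ (j - 1))
          (f (take (j - 1) (drop 1 us) @ [w (Suc j)] @ drop (j + 1) (drop 1 us)))))"
        if "j \<in> {1..n}" for j
        unfolding Gj[OF that] using that by (cases j) (auto simp: actions_scale mult.commute)
      then have sum1: "(\<Sum>j = 1..n. sM ((-1) ^ j) (G (Suc j))) = sM ((-1) ^ n) (r (us ! 0) S)"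
        by (simp add: S_def actions_sum M.scale_sum_right)
      show ?thesis
        unfolding cob B sumG sum1 G1
        using 1 us n
        by (cases "even n")
          (auto simp: f_Ind_symb[simplified] f_Ind_sum_symb[simplified] drop_take sign_scale
          actions_add actions_minus actions_diff T.add T.neg T.diff r_mult numeral_2_eq_2)
    next
      case 2
      (* The mirror image: G (n + 1) inserts T(u_(n+1)).u_(n+2) and so yields the term of the bracket
         that multiplies by T from the right. *)
      have Gn: "G (n + 1) = l (f (take n us) * T (us ! n)) (us ! (n + 1))"
        unfolding G_def using 2 us n
        by (simp add: R_map_def f_Ind_symb[simplified] l_mult nth_append)
      have Gi: "G i = l (f (take (i - 1) (take (n + 1) us) @ [w i] @ drop (i + 1) (take (n + 1) us)))
            (us ! (n + 1))"
        if "i \<in> {1..n}" for i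
      proof -
        define ys where "ys = take (i - 1) us @ [w i] @ drop (i + 1) us"
        have "length ys = n + 1"
          unfolding ys_def using us that by (auto simp: min_def)
        moreover have "ys ! n = us ! (n + 1)"
          unfolding ys_def using us that
          by (auto simp: nth_append nth_Cons min_def Suc_diff_le split: nat.splits)
        moreover have "take n ys = take (i - 1) (take (n + 1) us) @ [w i] @ drop (i + 1) (take (n + 1) us)"
          unfolding ys_def using us that by (cases i) (auto simp: take_Cons' drop_take min_def Suc_diff_le)
        moreover have "G i = ?g (symb (n + 1)) ys"
          using that 2 by (auto simp: G_def ys_def w_def R_map_def)
        ultimately show ?thesis
          using n by (simp add: f_Ind_symb)
      qed
      define S where "S = (\<Sum>i = 1..n. sA ((-1) ^ (i - 1))
            (f (take (i - 1) (take (n + 1) us) @ [w i] @ drop (i + 1) (take (n + 1) us))))"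
      have B: "bracket sA l r T n f (take (n + 1) us) =
          T (l (f (take n us)) (us ! n))
        - sA ((-1) ^ n) (T (r (us ! 0) (f (take n (drop 1 us)))))
        - sA ((-1) ^ n) S
        + sA ((-1) ^ n) (T (us ! 0) * f (take n (drop 1 us)))
        - f (take n us) * T (us ! n)"
        using us by (subst bracket_eq[OF f])
          (auto simp: w_def S_def drop_take min_def simp del: One_nat_def intro!: sum.cong)
      have sum2: "(\<Sum>i = 1..n. sM ((-1) ^ (i - 1)) (G i)) = l S (us ! (n + 1))"
        by (simp add: S_def actions_sum actions_scale Gi)
      have sumG': "(\<Sum>i = 1..n + 1. sM ((-1) ^ (i - 1)) (G i)) = l S (us ! (n + 1)) + sM ((-1) ^ n) (G (n + 1))"
        using sum2 by simp
      show ?thesis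
        unfolding cob B sumG' Gn
        using 2 us n
        by (cases "even n")
          (auto simp: f_Ind_symb[simplified] f_Ind_sum_symb[simplified] drop_take sign_scale min_def
          actions_add actions_minus actions_diff T.add T.neg T.diff l_mult)
    next
      case 3
      (* Since f_Ind lives on the first and the last symbol only, a middle symbol is seen in two terms
         of the sum: G 1 if k = 2, which cancels T(u1).(u2.f(u3, ...)), and G (n + 1) if k = n + 1,
         which cancels (f(u1, ...).u_(n+1)).T(u_(n+2)). Both can occur together, when n = 1. *)
      have G3: "G i = (if i = 1 then if k = 2 then
              sM ((-1) ^ (n + 1)) (r (l (T (us ! 0)) (us ! 1)) (f (drop 2 us))) else 0 else 0)
          + (if i = n + 1 then if k = n + 1 then
              l (f (take n us)) (r (us ! n) (T (us ! (n + 1)))) else 0 else 0)"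
        if "i \<in> {1..n + 1}" for i
      proof -
        have len: "length (take (i - 1) us @ x # drop (i + 1) us) = n + 1" for x
          using us that by (auto simp: min_def)
        have "i = 1 \<and> k = 2 \<or> i = n + 1 \<and> k = n + 1 \<or> R_map i 2 k \<in> {2..n}"
          using that 3 by (auto simp: R_map_def)
        then consider "i = 1" "k = 2" | "i = n + 1" "k = n + 1" | "R_map i 2 k \<in> {2..n}"
          by blast
        then show ?thesis
        proof cases
          case 1
          then show ?thesis
            unfolding G_def using us n by (simp add: R_map_def f_Ind_symb[simplified] numeral_2_eq_2)
        next
          case 2
          then show ?thesis
            unfolding G_def using us n by (simp add: R_map_def f_Ind_symb[simplified] nth_append)
        next
          case R: 3
          then have "\<not> (i = 1 \<and> k = 2)" "\<not> (i = n + 1 \<and> k = n + 1)"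
            by (auto simp: R_map_def)
          moreover have "G i = 0"
            unfolding G_def using R len by (simp add: f_Ind_symb)
          ultimately show ?thesis by auto
        qed
      qed
      have sumG3: "(\<Sum>i = 1..n + 1. sM ((-1) ^ (i - 1)) (G i)) =
          (if k = 2 then sM ((-1) ^ (n + 1)) (r (l (T (us ! 0)) (us ! 1)) (f (drop 2 us))) else 0)
        + (if k = n + 1 then sM ((-1) ^ n) (l (f (take n us)) (r (us ! n) (T (us ! (n + 1))))) else 0)"
      proof -
        have "(\<Sum>i = 1..n + 1. sM ((-1) ^ (i - 1)) (G i)) = (\<Sum>i = 1..n + 1.
           (if i = 1 then if k = 2 then
              sM ((-1) ^ (n + 1)) (r (l (T (us ! 0)) (us ! 1)) (f (drop 2 us))) else 0 else 0)
          + (if i = n + 1 then if k = n + 1 then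
              sM ((-1) ^ n) (l (f (take n us)) (r (us ! n) (T (us ! (n + 1))))) else 0 else 0))"
          using n by (intro sum.cong refl, subst G3) auto
        then show ?thesis by (simp only: sum.distrib) simp
      qed
      have gk: "?g (symb (k - 1)) (drop 1 us)
          = (if k = 2 then sM ((-1) ^ (n + 1)) (r (us ! 1) (f (drop 2 us))) else 0)"
        using 3 us n by (subst f_Ind_symb) (auto simp: numeral_2_eq_2)
      show ?thesis
        unfolding cob sumG3 gk
        using 3 us n
        by (cases "even n")
          (auto simp: f_Ind_symb[simplified] sign_scale
          actions_minus l_r numeral_2_eq_2 actions_zero)
    qed
  qed
  then show ?thesis
    unfolding M.dbracket_dend_pi[OF le_add2]
    by (subst (2) f_Ind_def) (intro M.lin_ext_cong, simp)
qed

end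

section \<open>Compatibility with the staircase differentials\<close>

lemma vector_space_fun_scale3:
  assumes "vector_space s"
  shows "vector_space (fun_scale (fun_scale (fun_scale s)))"
  by (intro vector_space_fun_scale assms)

context bimodule
begin

lemma subspace_C_cO: "module.subspace (scale_cO sA) (C_cO sA sM n)"
  unfolding scale_cO_def[abs_def] C_cO_def
  by (intro subspace_tuples vector_space_fun_scale A.subspace_Hom A.vector_space_axioms M.vector_space_axioms)

lemma linear_delta_cO:
  assumes "Vector_Spaces.linear sM sA T1" "Vector_Spaces.linear sM sA T2"
  shows "Vector_Spaces.linear (scale_cO sA) (scale_cO sA) (delta_cO sA l r T1 T2 n)"
  unfolding scale_cO_def[abs_def] delta_cO_def[abs_def]
  using assms by (intro linear_staircase linear_bracket)

lemma linear_delta0_cO: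
  assumes "Vector_Spaces.linear sM sA T1" "Vector_Spaces.linear sM sA T2"
  shows "Vector_Spaces.linear sA (scale_cO sA) (delta0_cO l r T1 T2)"
proof -
  interpret b1: Vector_Spaces.linear sA "fun_scale sA" "bracket0 l r T1" by (rule linear_bracket0) fact
  interpret b2: Vector_Spaces.linear sA "fun_scale sA" "bracket0 l r T2" by (rule linear_bracket0) fact
  show ?thesis
    unfolding Vector_Spaces.linear_iff scale_cO_def
    using A.vector_space_axioms
    by (auto simp: A.vector_space_fun_scale2 delta0_cO_def fun_eq_iff b1.add b2.add b1.scale b2.scale)
qed

lemma linear_Psi:
  "Vector_Spaces.linear (scale_cO sA) (scale_cDend sM) (Psi sM l r n)"
proof -
  interpret f: Vector_Spaces.linear "fun_scale sA" "fun_scale (fun_scale sM)" "f_Ind sM l r n"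
    by (rule linear_f_Ind)
  show ?thesis
    unfolding Vector_Spaces.linear_iff scale_cO_def scale_cDend_def
    by (auto simp: A.vector_space_fun_scale2 vector_space_fun_scale3[OF M.vector_space_axioms]
        Psi_def fun_eq_iff f.add f.scale)
qed

lemma Psi_in_C_cDend:
  assumes "F \<in> C_cO sA sM n"
  shows "Psi sM l r n F \<in> C_cDend sM (n + 1)"
  using assms by (auto simp: C_cO_def C_cDend_def tuples_def Psi_def f_Ind_in_HomC[simplified])

text \<open>Both differentials are staircases of the same length \<open>n + 2\<close>, so \<open>dbracket_f_Ind\<close> can be applied
  place by place.\<close>

lemma delta_cDend_Psi:
  assumes T: "Vector_Spaces.linear sM sA T1" "Vector_Spaces.linear sM sA T2"
    and F: "F \<in> C_cO sA sM n" and n: "n \<ge> 1"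
  shows "delta_cDend sM (M_Ind l r T1 T2) (n + 1) (Psi sM l r n F)
       = scale_cDend sM ((-1) ^ n) (Psi sM l r (n + 1) (delta_cO sA l r T1 T2 n F))"
proof -
  interpret f: Vector_Spaces.linear "fun_scale sA" "fun_scale (fun_scale sM)" "f_Ind sM l r (n + 1)"
    by (rule linear_f_Ind)
  have F: "F i \<in> Hom sM sA n" if "i \<in> {1..n + 1}" for i
    using F that by (auto simp: C_cO_def tuples_def)
  let ?b1 = "dbracket sM 2 (n + 1) (dend_pi sM (\<lambda>u v. r u (T1 v)) (\<lambda>u v. l (T1 u) v))"
    and ?b2 = "dbracket sM 2 (n + 1) (dend_pi sM (\<lambda>u v. r u (T2 v)) (\<lambda>u v. l (T2 u) v))"
  have b: "?b1 (f_Ind sM l r n (F i)) = f_Ind sM l r (n + 1) (bracket sA l r T1 n (F i))"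
    "?b2 (f_Ind sM l r n (F i)) = f_Ind sM l r (n + 1) (bracket sA l r T2 n (F i))"
    if "i \<in> {1..n + 1}" for i
    using dbracket_f_Ind[OF T(1) F[OF that] n] dbracket_f_Ind[OF T(2) F[OF that] n] by auto
  have "staircase ?b1 ?b2 (n + 1) (Psi sM l r n F) = Psi sM l r (n + 1) (delta_cO sA l r T1 T2 n F)"
  proof
    fix i
    consider "i = 1" | "i \<in> {2..n + 1}" | "i = n + 2" | "i \<notin> {1..n + 2}"
      by fastforce
    then show "staircase ?b1 ?b2 (n + 1) (Psi sM l r n F) i
        = Psi sM l r (n + 1) (delta_cO sA l r T1 T2 n F) i"
    proof cases
      case 1
      then show ?thesis using b(1)[of 1] by (simp add: staircase_def delta_cO_def Psi_def)
    next
      case 2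
      then have "i \<in> {1..n + 1}" "i - 1 \<in> {1..n + 1}" "i \<noteq> 1" by auto
      then show ?thesis
        using b(1)[of i] b(2)[of "i - 1"] 2
        by (simp add: staircase_def delta_cO_def Psi_def f.add[unfolded Suc_eq_plus1[symmetric]])
    next
      case 3
      then show ?thesis using b(2)[of "n + 1"] n by (simp add: staircase_def delta_cO_def Psi_def)
    next
      case 4
      then show ?thesis by (auto simp: staircase_def Psi_def)
    qed
  qed
  then show ?thesis
    by (simp add: delta_cDend_def M_Ind_def)
qed

text \<open>The substitute for \<open>\<Psi>\<^sub>0\<close>. For \<open>g u = a \<cdot> u - u \<cdot> a\<close> the bracket \<open>{{\<pi>\<^sub>T, g}}\<close> is the failure of \<open>g\<close> to be a
  derivation of both products; the terms in which \<open>a\<close> acts from outside cancel, and \<open>[T, a]\<close> is what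
  remains.\<close>

lemma delta_cDend_commutator:
  assumes T: "Vector_Spaces.linear sM sA T1" "Vector_Spaces.linear sM sA T2"
  defines "g \<equiv> \<lambda>a. lin_ext sM 1 (\<lambda>_ us. l a (us ! 0) - r (us ! 0) a)"
  shows "(\<lambda>i. if i = 1 then g a else 0) \<in> C_cDend sM 1"
    and "delta_cDend sM (M_Ind l r T1 T2) 1 (\<lambda>i. if i = 1 then g a else 0)
       = Psi sM l r 1 (delta0_cO l r T1 T2 a)"
proof -
  interpret MM: vector_space_pair sM sM ..
  have "g a \<in> HomC sM 1"
    unfolding g_def
  proof (rule M.lin_ext_in_HomC)
    show "multilinear sM sM 1 (\<lambda>us. l a (us ! 0) - r (us ! 0) a)"
      by (auto simp: multilinear_def intro!: MM.linear_compose_sub linear_actions)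
  qed
  then show "(\<lambda>i. if i = 1 then g a else 0) \<in> C_cDend sM 1"
    by (simp add: C_cDend_def tuples_def)
  have br: "dbracket sM 2 1 (dend_pi sM (\<lambda>u v. r u (T v)) (\<lambda>u v. l (T u) v)) (g a)
      = f_Ind sM l r 1 (bracket0 l r T a)" if T: "Vector_Spaces.linear sM sA T" for T
  proof -
    interpret T: Vector_Spaces.linear sM sA T by fact
    have g_symb: "g a (symb 1) [u] = l a u - r u a" for u
      unfolding g_def by (subst M.lin_ext_symb) auto
    have "dend_coboundary sM (\<lambda>u v. r u (T v)) (\<lambda>u v. l (T u) v) 1 (g a) k us =
      (if k = 1 then sM ((-1) ^ (1 + 1)) (r (us ! 0) (bracket0 l r T a (drop 1 us)))
       else if k = 1 + 1 then l (bracket0 l r T a (take 1 us)) (us ! 1)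
       else 0)"
      if k: "k \<in> {1..2}" and us: "length us = 2" for k us
    proof -
      obtain u v where "us = [u, v]"
        using us by (auto simp: numeral_2_eq_2 length_Suc_conv)
      moreover have "k = 1 \<or> k = 2" using k by auto
      ultimately show ?thesis
        by (auto simp: dend_coboundary_def bracket0_def g_symb[simplified] R_map_def
            actions_add actions_diff T.add T.diff r_mult l_mult l_r algebra_simps)
    qed
    then show ?thesis
      unfolding M.dbracket_dend_pi[OF order_refl]
      by (subst f_Ind_def) (intro M.lin_ext_cong, simp)
  qed
  show "delta_cDend sM (M_Ind l r T1 T2) 1 (\<lambda>i. if i = 1 then g a else 0)
       = Psi sM l r 1 (delta0_cO l r T1 T2 a)"
    using br[OF T(1)] br[OF T(2)]
    by (auto simp: fun_eq_iff delta_cDend_def scale_cDend_def M_Ind_def staircase_def Psi_def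
        delta0_cO_def)
qed

lemma linear_delta_cDend:
  assumes T: "Vector_Spaces.linear sM sA T1" "Vector_Spaces.linear sM sA T2" and n: "n \<ge> 1"
  shows "Vector_Spaces.linear (scale_cDend sM) (scale_cDend sM) (delta_cDend sM (M_Ind l r T1 T2) n)"
proof -
  have lin: "Vector_Spaces.linear (fun_scale (fun_scale sM)) (fun_scale (fun_scale sM))
      (dbracket sM 2 n (dend_pi sM (\<lambda>u v. r u (T v)) (\<lambda>u v. l (T u) v)))"
    if "Vector_Spaces.linear sM sA T" for T
    using bilinear_map_comp_left[OF l_bilinear that] bilinear_map_comp_right[OF r_bilinear that] n
    by (intro M.linear_dbracket_dend_pi)
  interpret S: Vector_Spaces.linear "fun_scale (fun_scale (fun_scale sM))"
      "fun_scale (fun_scale (fun_scale sM))"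
      "staircase (dbracket sM 2 n (dend_pi sM (\<lambda>u v. r u (T1 v)) (\<lambda>u v. l (T1 u) v)))
        (dbracket sM 2 n (dend_pi sM (\<lambda>u v. r u (T2 v)) (\<lambda>u v. l (T2 u) v))) n"
    by (intro linear_staircase lin T)
  show ?thesis
    unfolding Vector_Spaces.linear_iff scale_cDend_def[abs_def]
    using S.vs1.vector_space_axioms
    by (auto simp: delta_cDend_def scale_cDend_def M_Ind_def S.add S.scale M.scale_right_distrib
        fun_eq_iff mult.commute)
qed

lemma subspace_C_cDend: "module.subspace (scale_cDend sM) (C_cDend sM n)"
  unfolding scale_cDend_def[abs_def] C_cDend_def
  by (intro subspace_tuples M.vector_space_fun_scale2 M.subspace_HomC)

end

section \<open>The induced morphism on cohomology\<close>

theorem theorem5p12: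
  fixes sA :: "'k::field_char_0 \<Rightarrow> 'a::ring \<Rightarrow> 'a"
    and sM :: "'k \<Rightarrow> 'm::ab_group_add \<Rightarrow> 'm"
    and l :: "'a \<Rightarrow> 'm \<Rightarrow> 'm"
    and r :: "'m \<Rightarrow> 'a \<Rightarrow> 'm"
    and T1 T2 :: "'m \<Rightarrow> 'a"
  assumes "bimodule sA sM l r"
    and "compatible_O_operator sA sM l r T1 T2"
  shows "\<exists>\<Phi>. \<forall>n\<ge>1.
    (\<forall>F \<in> C_cO sA sM n. Psi sM l r n F \<in> C_cDend sM (n + 1)) \<and>
    (\<forall>F \<in> Z_cO sA sM l r T1 T2 n. Psi sM l r n F \<in> Z_cDend sM (M_Ind l r T1 T2) (n + 1)) \<and>
    (\<forall>F \<in> B_cO sA sM l r T1 T2 n. Psi sM l r n F \<in> B_cDend sM (M_Ind l r T1 T2) (n + 1)) \<and>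
    coh_linear
      (scale_cO sA) (Z_cO sA sM l r T1 T2 n) (B_cO sA sM l r T1 T2 n)
      (scale_cDend sM) (Z_cDend sM (M_Ind l r T1 T2) (n + 1)) (B_cDend sM (M_Ind l r T1 T2) (n + 1))
      (\<Phi> n) \<and>
    (\<forall>F \<in> Z_cO sA sM l r T1 T2 n.
       \<Phi> n (coh_class (Z_cO sA sM l r T1 T2 n) (B_cO sA sM l r T1 T2 n) F)
       = coh_class (Z_cDend sM (M_Ind l r T1 T2) (n + 1)) (B_cDend sM (M_Ind l r T1 T2) (n + 1))
           (Psi sM l r n F))"
proof -
  interpret bimodule sA sM l r by fact
  let ?D = "M_Ind l r T1 T2" and ?d = "delta_cO sA l r T1 T2" and ?\<Psi> = "Psi sM l r"
  let ?Z = "Z_cO sA sM l r T1 T2" and ?B = "B_cO sA sM l r T1 T2"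
  have T: "Vector_Spaces.linear sM sA T1" "Vector_Spaces.linear sM sA T2"
    using assms(2) by (auto simp: compatible_O_operator_def O_operator_def)
  have Z: "?\<Psi> n F \<in> Z_cDend sM ?D (n + 1)" if "n \<ge> 1" "F \<in> ?Z n" for n F
  proof -
    interpret Psi: Vector_Spaces.linear "scale_cO sA" "scale_cDend sM" "?\<Psi> (n + 1)"
      by (rule linear_Psi)
    show ?thesis
      using that by (simp add: Z_cO_def Z_cDend_def Psi_in_C_cDend[simplified]
          delta_cDend_Psi[OF T, simplified] Psi.zero[simplified])
  qed
  have B: "?\<Psi> n F \<in> B_cDend sM ?D (n + 1)" if n: "n \<ge> 1" and F: "F \<in> ?B n" for n F
  proof (cases "n = 1")
    case True
    then obtain a where "F = delta0_cO l r T1 T2 a" using F by (auto simp: B_cO_def)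
    moreover have "?\<Psi> 1 (delta0_cO l r T1 T2 a) \<in> delta_cDend sM ?D 1 ` C_cDend sM 1"
      by (rule image_eqI) (rule delta_cDend_commutator(2)[OF T, symmetric], rule delta_cDend_commutator(1)[OF T])
    ultimately show ?thesis
      using True by (simp add: B_cDend_def)
  next
    case False
    then obtain m where m: "n = m + 1" "m \<ge> 1" using n by (cases n) auto
    then obtain G where G: "G \<in> C_cO sA sM m" "F = ?d m G" using F by (auto simp: B_cO_def)
    interpret delta: Vector_Spaces.linear "scale_cDend sM" "scale_cDend sM" "delta_cDend sM ?D n"
      using linear_delta_cDend[OF T n] .
    (* The sign (-1)^m in delta_cDend_Psi is its own inverse, so it moves to the preimage. *)
    have "delta_cDend sM ?D n (scale_cDend sM ((-1) ^ m) (?\<Psi> m G))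
        = scale_cDend sM ((-1) ^ m) (delta_cDend sM ?D n (?\<Psi> m G))"
      by (rule delta.scale)
    also have "\<dots> = scale_cDend sM ((-1) ^ m) (scale_cDend sM ((-1) ^ m) (?\<Psi> n F))"
      using delta_cDend_Psi[OF T G(1) m(2)] m(1) G(2) by simp
    also have "\<dots> = ?\<Psi> n F"
      by (simp add: scale_cDend_def flip: power_mult_distrib)
    finally have "delta_cDend sM ?D n (scale_cDend sM ((-1) ^ m) (?\<Psi> m G)) = ?\<Psi> n F" .
    moreover have "scale_cDend sM ((-1) ^ m) (?\<Psi> m G) \<in> C_cDend sM n"
      using delta.vs1.subspace_scale[OF subspace_C_cDend Psi_in_C_cDend[OF G(1)]] m(1) by simp
    ultimately show ?thesis
      using n by (auto simp: B_cDend_def intro!: image_eqI)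
  qed
  have "\<exists>\<phi>. coh_linear (scale_cO sA) (?Z n) (?B n)
        (scale_cDend sM) (Z_cDend sM ?D (n + 1)) (B_cDend sM ?D (n + 1)) \<phi> \<and>
      (\<forall>F\<in>?Z n. \<phi> (coh_class (?Z n) (?B n) F)
        = coh_class (Z_cDend sM ?D (n + 1)) (B_cDend sM ?D (n + 1)) (?\<Psi> n F))"
    if n: "n \<ge> 1" for n
  proof (rule coh_linear_induced[OF linear_Psi])
    show "module.subspace (scale_cO sA) (?Z n)"
      unfolding Z_cO_def by (rule subspace_cocycles[OF linear_delta_cO[OF T] subspace_C_cO])
    show "module.subspace (scale_cDend sM) (Z_cDend sM ?D (n + 1))"
      unfolding Z_cDend_def
      by (rule subspace_cocycles[OF linear_delta_cDend[OF T le_add2] subspace_C_cDend])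
    interpret d0: Vector_Spaces.linear sA "scale_cO sA" "delta0_cO l r T1 T2"
      by (rule linear_delta0_cO[OF T])
    interpret d: Vector_Spaces.linear "scale_cO sA" "scale_cO sA" "?d (n - 1)"
      by (rule linear_delta_cO[OF T])
    show "module.subspace (scale_cO sA) (?B n)"
      using d0.subspace_image[OF A.subspace_UNIV] d.subspace_image[OF subspace_C_cO]
      by (simp add: B_cO_def)
    interpret D: Vector_Spaces.linear "scale_cDend sM" "scale_cDend sM" "delta_cDend sM ?D n"
      by (rule linear_delta_cDend[OF T n])
    show "module.subspace (scale_cDend sM) (B_cDend sM ?D (n + 1))"
      using D.subspace_image[OF subspace_C_cDend] n by (simp add: B_cDend_def)
  qed (use Z B n in auto)
  then obtain \<Phi> where "\<forall>n\<ge>1. coh_linear (scale_cO sA) (?Z n) (?B n)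
        (scale_cDend sM) (Z_cDend sM ?D (n + 1)) (B_cDend sM ?D (n + 1)) (\<Phi> n) \<and>
      (\<forall>F\<in>?Z n. \<Phi> n (coh_class (?Z n) (?B n) F)
        = coh_class (Z_cDend sM ?D (n + 1)) (B_cDend sM ?D (n + 1)) (?\<Psi> n F))"
    by metis
  with Z B Psi_in_C_cDend show ?thesis
    by (intro exI[of _ \<Phi>]) blast
qed

end
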